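(* Let $(\tilde{\mathcal{C}},\tilde\lambda)$ be a $(2n+3)$-dimensional contact manifold with canonical coordinates $(x,x^{n+1},p,p_{n+1},z)$, $\tilde\lambda=dz-p_a\,dx^a-p_{n+1}\,dx^{n+1}$. Let $\varphi$ be a function of $p=\{p_1,\dots,p_n\}$, $x^{n+1}_{(0)}$ a non-zero constant, $F_1,\dots,F_n$ functions of $p$ that do not identically vanish, and $\tilde\gamma^0$ a non-zero constant. Let $\tilde X$ be the contact Hamiltonian vector field associated to $$\tilde h=\Big(x^a-\frac{x^{n+1}}{x^{n+1}_{(0)}}\frac{\partial\varphi}{\partial p_a}(p)\Big)F_a(p)+\tilde\gamma^0\big(x^ip_i+(x^{n+1}-x^{n+1}_{(0)})p_{n+1}-\varphi(p)-z\big),$$ considered on the region $\tilde h>0$. Then, within the class of densities depending on the coordinates only through $\tilde h$, an invariant measure for $\tilde X$ is $$\tilde\Omega^{\mathrm{Inv}}=\tilde f^{\mathrm{Inv}}\,\tilde\Omega_{\tilde\lambda},\qquad \tilde f^{\mathrm{Inv}}=\frac{1}{\tilde Z}\,\tilde h^{-(n+2)},$$ where $\tilde Z$ is a non-zero constant.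
   Context: All objects are smooth; repeated indices $a,i$ are summed over $1,\dots,n$. The standard volume form is $\tilde\Omega_{\tilde\lambda}=\tilde\lambda\wedge\underbrace{d\tilde\lambda\wedge\dots\wedge d\tilde\lambda}_{n+1}$. An invariant measure for a vector field $X$ is a non-vanishing top-degree form $\Omega$ with $\partial\Omega/\partial t=0$ (no explicit time dependence) and $\mathcal{L}_X\Omega=0$. The contact Hamiltonian vector field of a function $\tilde h$ on $\tilde{\mathcal{C}}$ is defined by $\iota_{\tilde X}\tilde\lambda=\tilde h$, $\iota_{\tilde X}d\tilde\lambda=-(d\tilde h-(\partial\tilde h/\partial z)\tilde\lambda)$; in coordinates, for $\mu=1,\dots,n+1$, $\dot x^\mu=-\partial\tilde h/\partial p_\mu$, $\dot p_\mu=\partial\tilde h/\partial x^\mu+p_\mu\,\partial\tilde h/\partial z$, $\dot z=\tilde h-\sum_{\mu=1}^{n+1}p_\mu\,\partial\tilde h/\partial p_\mu$. *)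

theory Defs
  imports "HOL-Analysis.Analysis"
begin

section \<open>Smooth functions on an open set\<close>

fun Ck_on :: "nat \<Rightarrow> 'a::euclidean_space set \<Rightarrow> ('a \<Rightarrow> real) \<Rightarrow> bool" where
  "Ck_on 0 S f \<longleftrightarrow> continuous_on S f"
| "Ck_on (Suc k) S f \<longleftrightarrow>
     (\<forall>x\<in>S. f differentiable at x) \<and> (\<forall>v. Ck_on k S (\<lambda>x. frechet_derivative f (at x) v))"

definition smooth_on :: "'a::euclidean_space set \<Rightarrow> ('a \<Rightarrow> real) \<Rightarrow> bool" where
  "smooth_on S f \<longleftrightarrow> (\<forall>k. Ck_on k S f)"

section \<open>Differential forms on open subsets of a Euclidean space\<close>

text \<open>
  The value of a \<open>k\<close>-form at a point is an alternating \<open>k\<close>-linear function of the vectors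
  \<open>v 0, \<dots>, v (k - 1)\<close>; the remaining entries of the sequence \<open>v\<close> are ignored. The degree \<open>k\<close>
  is not part of the type and is passed to the operations that need it.
\<close>

type_synonym 'a form = "'a \<Rightarrow> (nat \<Rightarrow> 'a) \<Rightarrow> real"

definition alternating :: "nat \<Rightarrow> ((nat \<Rightarrow> 'a::real_vector) \<Rightarrow> real) \<Rightarrow> bool" where
  "alternating k \<alpha> \<longleftrightarrow>
     (\<forall>v w. (\<forall>i<k. v i = w i) \<longrightarrow> \<alpha> v = \<alpha> w) \<and>
     (\<forall>v. \<forall>i<k. linear (\<lambda>u. \<alpha> (v(i := u)))) \<and>
     (\<forall>v i j. i < j \<and> j < k \<and> v i = v j \<longrightarrow> \<alpha> v = 0)"

definition differential_form :: "nat \<Rightarrow> 'a::euclidean_space set \<Rightarrow> 'a form \<Rightarrow> bool" where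
  "differential_form k S \<omega> \<longleftrightarrow>
     (\<forall>x\<in>S. alternating k (\<omega> x)) \<and> (\<forall>v. smooth_on S (\<lambda>x. \<omega> x v))"

definition function_form :: "('a \<Rightarrow> real) \<Rightarrow> 'a form" where
  "function_form f = (\<lambda>x v. f x)"

definition scale_form :: "('a \<Rightarrow> real) \<Rightarrow> 'a form \<Rightarrow> 'a form" where
  "scale_form f \<omega> = (\<lambda>x v. f x * \<omega> x v)"

text \<open>Wedge product of a \<open>k\<close>-form and an \<open>l\<close>-form, normalised by \<open>1 / (k! l!)\<close>.\<close>

definition wedge :: "nat \<Rightarrow> nat \<Rightarrow> 'a form \<Rightarrow> 'a form \<Rightarrow> 'a form" where
  "wedge k l \<alpha> \<beta> = (\<lambda>x v.
     (\<Sum>\<sigma> | \<sigma> permutes {..<k + l}.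
        of_int (sign \<sigma>) * \<alpha> x (\<lambda>i. v (\<sigma> i)) * \<beta> x (\<lambda>j. v (\<sigma> (k + j)))) / (fact k * fact l))"

fun wedge_power :: "nat \<Rightarrow> 'a form \<Rightarrow> nat \<Rightarrow> 'a form" where
  "wedge_power k \<omega> 0 = function_form (\<lambda>x. 1)"
| "wedge_power k \<omega> (Suc m) = wedge k (k * m) \<omega> (wedge_power k \<omega> m)"

text \<open>
  \<open>(d\<omega>)(v\<^sub>0, \<dots>, v\<^sub>k) = \<Sum>i\<le>k. (-1)\<^sup>i D\<^bsub>v\<^sub>i\<^esub> (\<omega>(v\<^sub>0, \<dots>, v\<^sub>i omitted, \<dots>, v\<^sub>k))\<close>
  for vectors \<open>v\<^sub>i\<close> extended to constant vector fields, whose brackets vanish.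
\<close>

definition ext_deriv :: "nat \<Rightarrow> 'a::euclidean_space form \<Rightarrow> 'a form" where
  "ext_deriv k \<omega> = (\<lambda>x v. \<Sum>i\<le>k. (-1) ^ i *
     frechet_derivative (\<lambda>y. \<omega> y (\<lambda>j. if j < i then v j else v (Suc j))) (at x) (v i))"

definition interior_product :: "('a \<Rightarrow> 'a) \<Rightarrow> 'a form \<Rightarrow> 'a form" where
  "interior_product X \<omega> = (\<lambda>x v. \<omega> x (case_nat (X x) v))"

text \<open>
  \<open>(L\<^sub>X \<omega>)(V\<^sub>0, \<dots>) = X (\<omega>(V\<^sub>0, \<dots>)) - \<Sum>i<k. \<omega>(V\<^sub>0, \<dots>, [X, V\<^sub>i], \<dots>)\<close>, evaluated on constant
  vector fields \<open>V\<^sub>i\<close>, for which \<open>[X, V\<^sub>i] = - DX(V\<^sub>i)\<close>.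
\<close>

definition lie_deriv :: "nat \<Rightarrow> ('a::euclidean_space \<Rightarrow> 'a) \<Rightarrow> 'a form \<Rightarrow> 'a form" where
  "lie_deriv k X \<omega> = (\<lambda>x v.
     frechet_derivative (\<lambda>y. \<omega> y v) (at x) (X x) +
     (\<Sum>i<k. \<omega> x (v(i := frechet_derivative X (at x) (v i)))))"

definition nonvanishing_on :: "'a set \<Rightarrow> 'a form \<Rightarrow> bool" where
  "nonvanishing_on S \<omega> \<longleftrightarrow> (\<forall>x\<in>S. \<exists>v. \<omega> x v \<noteq> 0)"

text \<open>Forms that may depend explicitly on time are families \<open>\<Omega> t\<close> indexed by a real \<open>t\<close>.\<close>

definition invariant_measure ::
    "'a::euclidean_space set \<Rightarrow> ('a \<Rightarrow> 'a) \<Rightarrow> (real \<Rightarrow> 'a form) \<Rightarrow> bool" where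
  "invariant_measure S X \<Omega> \<longleftrightarrow>
     (\<forall>t. differential_form DIM('a) S (\<Omega> t)) \<and>
     (\<forall>t. nonvanishing_on S (\<Omega> t)) \<and>
     (\<forall>t. \<forall>x\<in>S. \<forall>v. ((\<lambda>s. \<Omega> s x v) has_real_derivative 0) (at t)) \<and>
     (\<forall>t. \<forall>x\<in>S. \<forall>v. lie_deriv DIM('a) X (\<Omega> t) x v = 0)"

section \<open>Contact geometry in canonical coordinates\<close>

definition contact_volume :: "nat \<Rightarrow> 'a::euclidean_space form \<Rightarrow> 'a form" where
  "contact_volume m \<theta> = wedge 1 (2 * m) \<theta> (wedge_power 2 (ext_deriv 1 \<theta>) m)"

definition contact_manifold :: "nat \<Rightarrow> 'a::euclidean_space set \<Rightarrow> 'a form \<Rightarrow> bool" where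
  "contact_manifold m C \<theta> \<longleftrightarrow>
     DIM('a) = 2 * m + 1 \<and> open C \<and> differential_form 1 C \<theta> \<and>
     nonvanishing_on C (contact_volume m \<theta>)"

text \<open>Coordinates \<open>(x, x\<^sup>n\<^sup>+\<^sup>1, p, p\<^sub>n\<^sub>+\<^sub>1, z)\<close> with \<open>n = CARD('n)\<close>; the dimension is \<open>2 n + 3\<close>.\<close>

type_synonym 'n phase = "(real ^ 'n) \<times> real \<times> (real ^ 'n) \<times> real \<times> real"

definition x_coord :: "'n::finite phase \<Rightarrow> real ^ 'n" where "x_coord c = fst c"
definition xlast_coord :: "'n::finite phase \<Rightarrow> real" where "xlast_coord c = fst (snd c)"
definition p_coord :: "'n::finite phase \<Rightarrow> real ^ 'n" where "p_coord c = fst (snd (snd c))"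
definition plast_coord :: "'n::finite phase \<Rightarrow> real" where
  "plast_coord c = fst (snd (snd (snd c)))"
definition z_coord :: "'n::finite phase \<Rightarrow> real" where "z_coord c = snd (snd (snd (snd c)))"

text \<open>
  \<open>dz - p\<^sub>a dx\<^sup>a - p\<^sub>n\<^sub>+\<^sub>1 dx\<^sup>n\<^sup>+\<^sup>1\<close>. The coordinates are linear functions, so the differential of a
  coordinate, evaluated at a vector, is that coordinate of the vector.
\<close>

definition canonical_contact_form :: "'n::finite phase form" where
  "canonical_contact_form = (\<lambda>c v.
     z_coord (v 0) - (\<Sum>a\<in>UNIV. p_coord c $ a * x_coord (v 0) $ a)
       - plast_coord c * xlast_coord (v 0))"

definition d_dz :: "('n::finite phase \<Rightarrow> real) \<Rightarrow> 'n phase \<Rightarrow> real" where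
  "d_dz h c = frechet_derivative h (at c) (0, 0, 0, 0, 1)"

definition d_dp :: "(real ^ 'n::finite \<Rightarrow> real) \<Rightarrow> 'n \<Rightarrow> real ^ 'n \<Rightarrow> real" where
  "d_dp \<phi> a p = frechet_derivative \<phi> (at p) (axis a 1)"

definition contact_hamiltonian_vector_field ::
    "'n::finite phase set \<Rightarrow> 'n phase form \<Rightarrow> ('n phase \<Rightarrow> real) \<Rightarrow> ('n phase \<Rightarrow> 'n phase) \<Rightarrow> bool" where
  "contact_hamiltonian_vector_field C \<theta> h X \<longleftrightarrow>
     (\<forall>c\<in>C. \<forall>v.
        interior_product X \<theta> c v = h c \<and>
        interior_product X (ext_deriv 1 \<theta>) c v =
          - (ext_deriv 0 (function_form h) c v - d_dz h c * \<theta> c v))"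

definition depends_only_through :: "'a set \<Rightarrow> ('a \<Rightarrow> real) \<Rightarrow> ('a \<Rightarrow> real) \<Rightarrow> bool" where
  "depends_only_through S h f \<longleftrightarrow> (\<exists>g. \<forall>c\<in>S. f c = g (h c))"

definition model_hamiltonian ::
    "(real ^ 'n \<Rightarrow> real) \<Rightarrow> ('n \<Rightarrow> real ^ 'n \<Rightarrow> real) \<Rightarrow> real \<Rightarrow> real \<Rightarrow> 'n::finite phase \<Rightarrow> real" where
  "model_hamiltonian \<phi> F x0 \<gamma> c =
     (\<Sum>a\<in>UNIV. (x_coord c $ a - xlast_coord c / x0 * d_dp \<phi> a (p_coord c)) * F a (p_coord c)) +
     \<gamma> * ((\<Sum>i\<in>UNIV. x_coord c $ i * p_coord c $ i) + (xlast_coord c - x0) * plast_coord c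
           - \<phi> (p_coord c) - z_coord c)"

end

theory Submission
  imports Defs
begin

text \<open>For the contact Hamiltonian field \<open>X\<close> of \<open>h\<close> the Lie derivative scales the contact form
  \<open>\<lambda>\<close> by \<open>\<partial>h/\<partial>z\<close>, which for the model Hamiltonian is the constant \<open>- \<gamma>\<close>. Hence it scales \<open>d\<lambda>\<close>
  by the same constant and, being a derivation, it scales the standard volume form by
  \<open>- (n + 2) \<gamma>\<close>; the volume form itself need not be evaluated. Moreover \<open>X h = - \<gamma> h\<close>, so a
  density \<open>g \<circ> h\<close> is invariant if and only if \<open>t g'(t) = - (n + 2) g(t)\<close>. The values of \<open>h\<close> on
  \<open>h > 0\<close> form an open interval when the manifold is connected, so \<open>g\<close> is a multiple of the
  power \<open>- (n + 2)\<close>.\<close>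

section \<open>Smooth functions\<close>

text \<open>Regularity is the main obstacle. \<open>X\<close> is only a pointwise solution of its
  two defining equations, yet \<open>lie_deriv\<close> differentiates it; since
  \<open>d\<lambda>\<close> detects every x- and p-direction and \<open>\<lambda>\<close> the
  remaining one, these equations express the components of \<open>X\<close> by derivatives of
  \<open>h\<close>, hence make \<open>X\<close> differentiable. A competing density
  \<open>f = g \<circ> h\<close> comes with no regularity of \<open>f\<close> or \<open>g\<close>:
  \<open>f\<close> is recovered by dividing the smooth form by a nonzero value of the volume, and
  \<open>g\<close> by restricting \<open>f\<close> to a line in the z-direction, along which
  \<open>h\<close> is affine with slope \<open>- \<gamma>\<close>. The Lie derivatives of
  \<open>\<lambda>\<close> and \<open>d\<lambda>\<close> come from differentiating the defining
  equations. For \<open>d\<lambda>\<close> this produces second derivatives of \<open>h\<close>,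
  which cancel only by their symmetry; hence the second differences. Connectedness enters because a
  value set of \<open>h\<close> made of several intervals would allow a different multiple of the
  power on each of them.\<close>

lemma Ck_on_cong:
  assumes "open S" "\<And>x. x \<in> S \<Longrightarrow> f x = g x" "Ck_on k S f"
  shows "Ck_on k S g"
  using assms
proof (induction k arbitrary: f g)
  case 0
  then show ?case by (metis Ck_on.simps(1) continuous_on_cong)
next
  case (Suc k)
  \<comment> \<open>Agreement on an open set is agreement near each of its points, so the
    derivatives coincide and the induction can pass to them.\<close>
  have D: "(g has_derivative frechet_derivative f (at x)) (at x)" if "x \<in> S" for x
    using Suc.prems that has_derivative_transform_within_open[of f _ x UNIV S g]
    by (auto simp: frechet_derivative_works[symmetric])
  then have eq: "frechet_derivative f (at x) = frechet_derivative g (at x)" if "x \<in> S" for x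
    using frechet_derivative_at that by blast
  have "Ck_on k S (\<lambda>x. frechet_derivative g (at x) v)" for v
    by (rule Suc.IH[of "\<lambda>x. frechet_derivative f (at x) v"]) (use Suc.prems eq in auto)
  moreover have "g differentiable at x" if "x \<in> S" for x
    using D[OF that] by (auto simp: differentiable_def)
  ultimately show ?case by simp
qed

text \<open>Derivatives of products and inverses contain undifferentiated factors, so inductions on
  the order need those factors at the order below.\<close>

lemma Ck_on_SucD:
  assumes "Ck_on (Suc k) S f" shows "Ck_on k S f"
  using assms
proof (induction k arbitrary: f)
  case 0
  then show ?case
    by (auto simp: differentiable_imp_continuous_within continuous_at_imp_continuous_on)
next
  case (Suc k)
  then show ?case by (metis Ck_on.simps(2))
qed

lemma Ck_on_const: "Ck_on k S (\<lambda>x. c)"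
  by (induction k arbitrary: c) auto

lemma frechet_derivative_add_at:
  assumes "f differentiable at x" "g differentiable at x"
  shows "frechet_derivative (\<lambda>x. f x + g x) (at x) v =
    frechet_derivative f (at x) v + frechet_derivative g (at x) v"
  using frechet_derivative_at[OF has_derivative_add] assms
  by (metis (mono_tags, lifting) frechet_derivative_works)

lemma frechet_derivative_mult_at:
  fixes f g :: "'a::euclidean_space \<Rightarrow> real"
  assumes "f differentiable at x" "g differentiable at x"
  shows "frechet_derivative (\<lambda>x. f x * g x) (at x) v =
    f x * frechet_derivative g (at x) v + frechet_derivative f (at x) v * g x"
  using frechet_derivative_at[OF has_derivative_mult] assms
  by (metis (mono_tags, lifting) frechet_derivative_works)

lemma Ck_on_add:
  assumes "open S" "Ck_on k S f" "Ck_on k S g"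
  shows "Ck_on k S (\<lambda>x. f x + g x)"
  using assms(2,3)
proof (induction k arbitrary: f g)
  case 0
  then show ?case by (auto intro: continuous_intros)
next
  case (Suc k)
  have "Ck_on k S (\<lambda>x. frechet_derivative (\<lambda>x. f x + g x) (at x) v)" for v
    by (rule Ck_on_cong[OF assms(1) _ Suc.IH[of "\<lambda>x. frechet_derivative f (at x) v" "\<lambda>x. frechet_derivative g (at x) v"]])
      (use Suc.prems in \<open>auto simp: frechet_derivative_add_at\<close>)
  then show ?case using Suc.prems by auto
qed

lemma Ck_on_mult:
  assumes "open S" "Ck_on k S f" "Ck_on k S g"
  shows "Ck_on k S (\<lambda>x. f x * g x)"
  using assms(2,3)
proof (induction k arbitrary: f g)
  case 0
  then show ?case by (auto intro: continuous_intros)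
next
  case (Suc k)
  have "Ck_on k S (\<lambda>x. f x * frechet_derivative g (at x) v + frechet_derivative f (at x) v * g x)" for v
    using Suc.prems Ck_on_SucD[OF Suc.prems(1)] Ck_on_SucD[OF Suc.prems(2)]
    by (intro Ck_on_add[OF assms(1)] Suc.IH) auto
  then have "Ck_on k S (\<lambda>x. frechet_derivative (\<lambda>x. f x * g x) (at x) v)" for v
    by (rule Ck_on_cong[OF assms(1), rotated]) (use Suc.prems in \<open>auto simp: frechet_derivative_mult_at\<close>)
  then show ?case using Suc.prems by auto
qed

lemma Ck_on_inverse:
  assumes "open S" "Ck_on k S f" "\<And>x. x \<in> S \<Longrightarrow> f x \<noteq> 0"
  shows "Ck_on k S (\<lambda>x. inverse (f x))"
  using assms(2)
proof (induction k)
  case 0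
  then show ?case using assms by (auto intro: continuous_intros)
next
  case (Suc k)
  then have IH: "Ck_on k S (\<lambda>x. inverse (f x))" using Ck_on_SucD by blast
  \<comment> \<open>The derivative contains the inverse itself, which \<open>IH\<close> supplies at
    order \<open>k\<close>. Writing the sign as a factor \<open>- 1\<close> leaves only
    products.\<close>
  have D: "((\<lambda>x. inverse (f x)) has_derivative
      (\<lambda>v. - 1 * (inverse (f x) * frechet_derivative f (at x) v * inverse (f x)))) (at x)" if "x \<in> S" for x
    using Suc.prems that assms(3)
    by (auto intro!: derivative_eq_intros simp: frechet_derivative_works[symmetric])
  have "Ck_on k S (\<lambda>x. - 1 * (inverse (f x) * frechet_derivative f (at x) v * inverse (f x)))" for v
    using Suc.prems IH by (intro Ck_on_mult Ck_on_const assms(1)) auto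
  then have "Ck_on k S (\<lambda>x. frechet_derivative (\<lambda>x. inverse (f x)) (at x) v)" for v
    by (rule Ck_on_cong[OF assms(1), rotated])
      (use D[THEN frechet_derivative_at, THEN fun_cong] in simp)
  with D show ?case by (auto simp: differentiable_def)
qed

text \<open>For a linear inner map, a directional derivative of the composite is again a function
  composed with \<open>L\<close>, taken in the fixed direction \<open>L v\<close>, so the induction
  closes. The Hamiltonian needs this for \<open>L = p_coord\<close>.\<close>

lemma Ck_on_compose_linear:
  assumes "open S" "bounded_linear L" "Ck_on k (L ` S) f"
  shows "Ck_on k S (\<lambda>x. f (L x))"
  using assms(3)
proof (induction k arbitrary: f)
  case 0
  then show ?case
    using continuous_on_compose2[of "L ` S" f S L] linear_continuous_on[OF assms(2)] by auto
next
  case (Suc k)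
  have D: "((\<lambda>x. f (L x)) has_derivative (\<lambda>v. frechet_derivative f (at (L x)) (L v))) (at x)"
    if "x \<in> S" for x
    using Suc.prems that
    by (intro has_derivative_compose[OF bounded_linear_imp_has_derivative[OF assms(2)]])
      (auto simp: frechet_derivative_works[symmetric])
  have "Ck_on k S (\<lambda>x. frechet_derivative f (at (L x)) (L v))" for v
    using Suc.prems by (intro Suc.IH) auto
  then have "Ck_on k S (\<lambda>x. frechet_derivative (\<lambda>x. f (L x)) (at x) v)" for v
    by (rule Ck_on_cong[OF assms(1), rotated])
      (use D[THEN frechet_derivative_at, THEN fun_cong] in simp)
  with D show ?case by (auto simp: differentiable_def)
qed

lemma smooth_onD:
  assumes "smooth_on S f" "x \<in> S"
  shows "f differentiable at x"
  using assms Ck_on.simps(2) unfolding smooth_on_def by blast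

lemma smooth_on_has_derivative:
  assumes "smooth_on S f" "x \<in> S"
  shows "(f has_derivative frechet_derivative f (at x)) (at x)"
  using smooth_onD[OF assms] by (simp add: frechet_derivative_works)

lemma smooth_on_frechet_derivative:
  "smooth_on S f \<Longrightarrow> smooth_on S (\<lambda>x. frechet_derivative f (at x) v)"
  unfolding smooth_on_def by (metis Ck_on.simps(2))

lemma smooth_on_continuous_on: "smooth_on S f \<Longrightarrow> continuous_on S f"
  unfolding smooth_on_def by (metis Ck_on.simps(1))

lemma Ck_on_subset: "Ck_on k S f \<Longrightarrow> T \<subseteq> S \<Longrightarrow> Ck_on k T f"
  by (induction k arbitrary: f) (auto intro: continuous_on_subset)

lemma smooth_on_subset: "smooth_on S f \<Longrightarrow> T \<subseteq> S \<Longrightarrow> smooth_on T f"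
  unfolding smooth_on_def using Ck_on_subset by blast

lemma smooth_on_const: "smooth_on S (\<lambda>x. c)"
  unfolding smooth_on_def using Ck_on_const by blast

lemma smooth_on_add:
  "open S \<Longrightarrow> smooth_on S f \<Longrightarrow> smooth_on S g \<Longrightarrow> smooth_on S (\<lambda>x. f x + g x)"
  unfolding smooth_on_def using Ck_on_add by blast

lemma smooth_on_mult:
  "open S \<Longrightarrow> smooth_on S f \<Longrightarrow> smooth_on S g \<Longrightarrow> smooth_on S (\<lambda>x. f x * g x)"
  unfolding smooth_on_def using Ck_on_mult by blast

lemma smooth_on_diff:
  assumes "open S" "smooth_on S f" "smooth_on S g"
  shows "smooth_on S (\<lambda>x. f x - g x)"
  using smooth_on_add[OF assms(1,2) smooth_on_mult[OF assms(1) smooth_on_const assms(3), of "-1"]]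
  by simp

lemma smooth_on_sum:
  assumes "open S" "\<And>i. i \<in> I \<Longrightarrow> smooth_on S (f i)"
  shows "smooth_on S (\<lambda>x. \<Sum>i\<in>I. f i x)"
  using assms(2)
  by (induction I rule: infinite_finite_induct) (auto intro: smooth_on_const smooth_on_add[OF assms(1)])

lemma smooth_on_power:
  assumes "open S" "smooth_on S f"
  shows "smooth_on S (\<lambda>x. f x ^ n)"
  by (induction n) (auto intro: smooth_on_const smooth_on_mult assms)

lemma smooth_on_inverse:
  "open S \<Longrightarrow> smooth_on S f \<Longrightarrow> (\<And>x. x \<in> S \<Longrightarrow> f x \<noteq> 0) \<Longrightarrow> smooth_on S (\<lambda>x. inverse (f x))"
  unfolding smooth_on_def using Ck_on_inverse by blast

lemma smooth_on_compose_linear: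
  "open S \<Longrightarrow> bounded_linear L \<Longrightarrow> smooth_on (L ` S) f \<Longrightarrow> smooth_on S (\<lambda>x. f (L x))"
  unfolding smooth_on_def using Ck_on_compose_linear by blast

lemma smooth_on_linear:
  assumes "bounded_linear (L :: 'a::euclidean_space \<Rightarrow> real)"
  shows "smooth_on S L"
proof -
  have "frechet_derivative L (at x) = L" for x
    using frechet_derivative_at[OF bounded_linear_imp_has_derivative[OF assms]] by simp
  then have "Ck_on (Suc k) S L" for k
    using bounded_linear_imp_differentiable[OF assms] by (simp add: Ck_on_const)
  then show ?thesis unfolding smooth_on_def using Ck_on_SucD by blast
qed

text \<open>The mean value theorem is applied twice, along \<open>u\<close> and then along
  \<open>v\<close>. The second difference is symmetric in \<open>u\<close> and \<open>v\<close>, so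
  exchanging them compares the two mixed derivatives.\<close>

lemma second_difference_mean_value:
  fixes f :: "'a::euclidean_space \<Rightarrow> real"
  assumes smooth: "smooth_on S f" and s: "s > 0"
    and sub: "\<And>a b. 0 \<le> a \<Longrightarrow> a \<le> s \<Longrightarrow> 0 \<le> b \<Longrightarrow> b \<le> s \<Longrightarrow> x + a *\<^sub>R u + b *\<^sub>R v \<in> S"
  obtains a b where "0 \<le> a" "a \<le> s" "0 \<le> b" "b \<le> s"
    "f (x + s *\<^sub>R u + s *\<^sub>R v) - f (x + s *\<^sub>R u) - f (x + s *\<^sub>R v) + f x =
     s * s * frechet_derivative (\<lambda>y. frechet_derivative f (at y) u) (at (x + a *\<^sub>R u + b *\<^sub>R v)) v"
proof -
  have line: "((\<lambda>t. g (y + t *\<^sub>R w)) has_real_derivative frechet_derivative g (at (y + t *\<^sub>R w)) w) (at t)"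
    if "smooth_on S g" "y + t *\<^sub>R w \<in> S" for g :: "'a \<Rightarrow> real" and y w t
  proof -
    have "((\<lambda>t. g (y + t *\<^sub>R w)) has_derivative
        (\<lambda>h. frechet_derivative g (at (y + t *\<^sub>R w)) (h *\<^sub>R w))) (at t)"
      by (rule has_derivative_compose[where g = g and f = "\<lambda>t. y + t *\<^sub>R w",
            OF _ smooth_on_has_derivative[OF that]])
        (auto intro!: derivative_eq_intros)
    moreover have "frechet_derivative g (at (y + t *\<^sub>R w)) (h *\<^sub>R w) =
        h * frechet_derivative g (at (y + t *\<^sub>R w)) w" for h
      using linear_frechet_derivative[OF smooth_onD[OF that]] by (simp add: linear_scale)
    ultimately show ?thesis
      by (simp add: has_field_derivative_def mult_commute_abs)
  qed
  \<comment> \<open>The second difference is the increment over \<open>[0, s]\<close> of this first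
    difference in direction \<open>v\<close>.\<close>
  define \<psi> where "\<psi> = (\<lambda>t. f ((x + s *\<^sub>R v) + t *\<^sub>R u) - f (x + t *\<^sub>R u))"
  let ?D = "\<lambda>y. frechet_derivative f (at y) u"
  have "(\<psi> has_real_derivative (?D ((x + s *\<^sub>R v) + t *\<^sub>R u) - ?D (x + t *\<^sub>R u))) (at t)"
    if "0 \<le> t" "t \<le> s" for t
    unfolding \<psi>_def using sub[of t s] sub[of t 0] s that
    by (intro DERIV_diff line[OF smooth]) (auto simp: algebra_simps)
  from MVT2[OF s this] obtain a where a: "0 < a" "a < s"
    "\<psi> s - \<psi> 0 = s * (?D ((x + s *\<^sub>R v) + a *\<^sub>R u) - ?D (x + a *\<^sub>R u))" by auto
  have "((\<lambda>t. ?D ((x + a *\<^sub>R u) + t *\<^sub>R v)) has_real_derivative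
      frechet_derivative ?D (at ((x + a *\<^sub>R u) + t *\<^sub>R v)) v) (at t)"
    if "0 \<le> t" "t \<le> s" for t
    using sub[of a t] a that by (intro line smooth_on_frechet_derivative smooth) auto
  from MVT2[OF s this] obtain b where b: "0 < b" "b < s"
    "?D ((x + a *\<^sub>R u) + s *\<^sub>R v) - ?D (x + a *\<^sub>R u) =
     s * frechet_derivative ?D (at ((x + a *\<^sub>R u) + b *\<^sub>R v)) v" by auto
  have "f (x + s *\<^sub>R u + s *\<^sub>R v) - f (x + s *\<^sub>R u) - f (x + s *\<^sub>R v) + f x = \<psi> s - \<psi> 0"
    by (simp add: \<psi>_def algebra_simps)
  also have "\<dots> = s * (?D ((x + a *\<^sub>R u) + s *\<^sub>R v) - ?D (x + a *\<^sub>R u))"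
    using a by (simp add: algebra_simps)
  finally show thesis
    using that[of a b] a b by simp
qed

text \<open>Schwarz's theorem: on small parallelograms both mixed derivatives take a common value,
  at possibly different points, and continuity carries the equality to \<open>x\<close>.\<close>

lemma smooth_on_mixed_derivatives_commute:
  fixes f :: "'a::euclidean_space \<Rightarrow> real"
  assumes "open S" and smooth: "smooth_on S f" and x: "x \<in> S"
  shows "frechet_derivative (\<lambda>y. frechet_derivative f (at y) u) (at x) v =
    frechet_derivative (\<lambda>y. frechet_derivative f (at y) v) (at x) u" (is "?A x = ?B x")
proof -
  obtain r where r: "r > 0" "ball x r \<subseteq> S" using assms open_contains_ball by blast
  \<comment> \<open>The summand 1 keeps \<open>M\<close> positive when \<open>u\<close> and
    \<open>v\<close> both vanish, since \<open>s\<close> is obtained by dividing by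
    \<open>M\<close>.\<close>
  define M where "M = norm u + norm v + 1"
  have M: "M > 0" by (simp add: M_def add_nonneg_pos)
  have near: "dist (x + a *\<^sub>R u + b *\<^sub>R v) x < d"
    if "0 \<le> a" "a \<le> s" "0 \<le> b" "b \<le> s" "s * M < d" for a b s d
  proof -
    have "dist (x + a *\<^sub>R u + b *\<^sub>R v) x = norm (a *\<^sub>R u + b *\<^sub>R v)"
      by (simp add: dist_norm algebra_simps)
    also have "\<dots> \<le> a * norm u + b * norm v"
      using norm_triangle_ineq[of "a *\<^sub>R u" "b *\<^sub>R v"] that by simp
    also have "\<dots> \<le> s * norm u + s * norm v"
      using that by (intro add_mono mult_right_mono) auto
    also have "\<dots> \<le> s * M" using that by (simp add: M_def algebra_simps)
    finally show ?thesis using that by simp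
  qed
  have contA: "continuous_on S ?A" and contB: "continuous_on S ?B"
    using smooth by (auto intro!: smooth_on_continuous_on smooth_on_frechet_derivative)
  have "dist (?A x) (?B x) < e" if "e > 0" for e
  proof -
    obtain d1 where d1: "d1 > 0" "\<And>y. y \<in> S \<Longrightarrow> dist y x < d1 \<Longrightarrow> dist (?A y) (?A x) < e / 2"
      using contA x \<open>e > 0\<close> unfolding continuous_on_iff by (metis half_gt_zero)
    obtain d2 where d2: "d2 > 0" "\<And>y. y \<in> S \<Longrightarrow> dist y x < d2 \<Longrightarrow> dist (?B y) (?B x) < e / 2"
      using contB x \<open>e > 0\<close> unfolding continuous_on_iff by (metis half_gt_zero)
    define d where "d = Min {r, d1, d2}"
    have d: "0 < d" "d \<le> r" "d \<le> d1" "d \<le> d2" using r d1 d2 by (auto simp: d_def)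
    \<comment> \<open>This gives \<open>s * M = d / 2\<close>, so the whole parallelogram with sides
      \<open>s *\<^sub>R u\<close> and \<open>s *\<^sub>R v\<close> lies within \<open>d\<close> of
      \<open>x\<close>.\<close>
    define s where "s = d / (2 * M)"
    have s: "s > 0" "s * M < d" using d M by (auto simp: s_def)
    have S: "x + a *\<^sub>R u + b *\<^sub>R v \<in> S" if "0 \<le> a" "a \<le> s" "0 \<le> b" "b \<le> s" for a b
      using near[OF that s(2)] d r by (auto simp: dist_commute)
    obtain a b where ab: "0 \<le> a" "a \<le> s" "0 \<le> b" "b \<le> s"
      "f (x + s *\<^sub>R u + s *\<^sub>R v) - f (x + s *\<^sub>R u) - f (x + s *\<^sub>R v) + f x =
       s * s * ?A (x + a *\<^sub>R u + b *\<^sub>R v)"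
      by (rule second_difference_mean_value[OF smooth s(1), of x u v]) (rule S)
    have S': "x + a *\<^sub>R v + b *\<^sub>R u \<in> S" if "0 \<le> a" "a \<le> s" "0 \<le> b" "b \<le> s" for a b
      using S[of b a] that by (simp add: algebra_simps)
    obtain a' b' where ab': "0 \<le> a'" "a' \<le> s" "0 \<le> b'" "b' \<le> s"
      "f (x + s *\<^sub>R v + s *\<^sub>R u) - f (x + s *\<^sub>R v) - f (x + s *\<^sub>R u) + f x =
       s * s * ?B (x + a' *\<^sub>R v + b' *\<^sub>R u)"
      by (rule second_difference_mean_value[OF smooth s(1), of x v u]) (rule S')
    have "s * s * ?A (x + a *\<^sub>R u + b *\<^sub>R v) = s * s * ?B (x + b' *\<^sub>R u + a' *\<^sub>R v)"
      using ab(5) ab'(5) by (simp add: algebra_simps)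
    then have "?A (x + a *\<^sub>R u + b *\<^sub>R v) = ?B (x + b' *\<^sub>R u + a' *\<^sub>R v)" using s by simp
    moreover have "dist (?A (x + a *\<^sub>R u + b *\<^sub>R v)) (?A x) < e / 2"
      using near[OF ab(1-4) s(2)] d by (intro d1 S ab) simp
    moreover have "dist (?B (x + b' *\<^sub>R u + a' *\<^sub>R v)) (?B x) < e / 2"
      using near[OF ab'(3,4,1,2) s(2)] d by (intro d2 S ab') simp
    ultimately show ?thesis by (metis dist_triangle_half_r)
  qed
  then show ?thesis by (metis dist_pos_lt less_irrefl)
qed

section \<open>Wedge products and Lie derivatives\<close>

lemma sum_lessThan_add:
  fixes g :: "nat \<Rightarrow> 'a::comm_monoid_add"
  shows "(\<Sum>m<k + l. g m) = (\<Sum>m<k. g m) + (\<Sum>j<l. g (k + j))"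
  by (induction l) (simp_all add: add.assoc)

text \<open>By injectivity of the permutation, a changed argument appears at one position only. The
  map \<open>g\<close> selects the block of a factor: the identity for the first,
  \<open>k + j\<close> for the second.\<close>

lemma permutes_fun_upd:
  assumes "\<sigma> permutes S"
  shows "(\<lambda>m. (v(\<sigma> i := u)) (\<sigma> (g m))) = (\<lambda>m. if g m = i then u else v (\<sigma> (g m)))"
  using permutes_inj[OF assms] by (auto simp: fun_eq_iff inj_eq)

lemma alternating_cong:
  "alternating k \<alpha> \<Longrightarrow> (\<And>i. i < k \<Longrightarrow> v i = w i) \<Longrightarrow> \<alpha> v = \<alpha> w"
  unfolding alternating_def by blast

lemma alternating_linear:
  "alternating k \<alpha> \<Longrightarrow> i < k \<Longrightarrow> linear (\<lambda>u. \<alpha> (v(i := u)))"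
  unfolding alternating_def by blast

lemma alternating_wedge:
  assumes \<alpha>: "alternating k (\<alpha> x)" and \<beta>: "alternating l (\<beta> x)"
  shows "alternating (k + l) (wedge k l \<alpha> \<beta> x)"
proof -
  let ?P = "{\<sigma>. \<sigma> permutes {..<k + l}}"
  let ?T = "\<lambda>v \<sigma>. of_int (sign \<sigma>) * \<alpha> x (\<lambda>i. v (\<sigma> i)) * \<beta> x (\<lambda>j. v (\<sigma> (k + j)))"
  have "wedge k l \<alpha> \<beta> x v = wedge k l \<alpha> \<beta> x w" if "\<forall>i<k + l. v i = w i" for v w
  proof -
    have eq: "v (\<sigma> i) = w (\<sigma> i)" if "\<sigma> permutes {..<k + l}" "i < k + l" for \<sigma> i
      using permutes_in_image[OF that(1), of i] that(2) \<open>\<forall>i<k + l. v i = w i\<close> by simp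
    have "?T v \<sigma> = ?T w \<sigma>" if "\<sigma> \<in> ?P" for \<sigma>
      using that eq alternating_cong[OF \<alpha>, of "\<lambda>i. v (\<sigma> i)" "\<lambda>i. w (\<sigma> i)"]
        alternating_cong[OF \<beta>, of "\<lambda>j. v (\<sigma> (k + j))" "\<lambda>j. w (\<sigma> (k + j))"] by simp
    then have "sum (?T v) ?P = sum (?T w) ?P" by (intro sum.cong refl)
    then show ?thesis unfolding wedge_def by simp
  qed
  moreover have "linear (\<lambda>u. wedge k l \<alpha> \<beta> x (v(i := u)))" if i: "i < k + l" for v i
  proof -
    have "linear (\<lambda>u. ?T (v(i := u)) \<sigma>)" if \<sigma>: "\<sigma> permutes {..<k + l}" for \<sigma>
    proof -
      \<comment> \<open>The position at which argument \<open>i\<close> arrives after permuting; it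
        belongs to the first factor exactly when \<open>m < k\<close>, so each term is linear
        through just one factor.\<close>
      define m where "m = inv \<sigma> i"
      have m: "m < k + l" "\<sigma> m = i"
        using permutes_in_image[OF permutes_inv[OF \<sigma>], of i] permutes_inverses[OF \<sigma>] i
        by (auto simp: m_def)
      have upd: "(\<lambda>j. (v(i := u)) (\<sigma> (g j))) = (\<lambda>j. if g j = m then u else v (\<sigma> (g j)))" for g :: "nat \<Rightarrow> nat" and u
        using permutes_fun_upd[OF \<sigma>, of v m u g] m by simp
      show ?thesis
      proof (cases "m < k")
        case True
        have eq: "?T (v(i := u)) \<sigma> = (of_int (sign \<sigma>) * \<beta> x (\<lambda>j. v (\<sigma> (k + j)))) *\<^sub>R
            \<alpha> x ((\<lambda>j. v (\<sigma> j))(m := u))" for u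
          using True upd[of u "\<lambda>j. j"] upd[of u "\<lambda>j. k + j"] by (simp add: fun_upd_def)
        show ?thesis
          unfolding eq by (rule linear_compose_scale_right[OF alternating_linear[OF \<alpha> True]])
      next
        case False
        then obtain j where j: "m = k + j" "j < l" using m by (metis le_add_diff_inverse nat_add_left_cancel_less not_less)
        have "\<alpha> x (\<lambda>i'. (v(i := u)) (\<sigma> i')) = \<alpha> x (\<lambda>i. v (\<sigma> i))" for u
          using False upd[of u "\<lambda>j. j"] by (intro alternating_cong[OF \<alpha>]) (auto simp: fun_eq_iff)
        moreover have "(\<lambda>j'. (v(i := u)) (\<sigma> (k + j'))) = (\<lambda>j. v (\<sigma> (k + j)))(j := u)" for u
          using j upd[of u "\<lambda>j. k + j"] by (simp add: fun_upd_def)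
        ultimately have eq: "?T (v(i := u)) \<sigma> = (of_int (sign \<sigma>) * \<alpha> x (\<lambda>i. v (\<sigma> i))) *\<^sub>R
            \<beta> x ((\<lambda>j. v (\<sigma> (k + j)))(j := u))" for u
          by simp
        show ?thesis
          unfolding eq by (rule linear_compose_scale_right[OF alternating_linear[OF \<beta> j(2)]])
      qed
    qed
    then have "linear (\<lambda>u. (1 / (fact k * fact l)) *\<^sub>R (\<Sum>\<sigma>\<in>?P. ?T (v(i := u)) \<sigma>))"
      by (intro linear_compose_scale_right linear_compose_sum) auto
    then show ?thesis unfolding wedge_def by simp
  qed
  moreover have "wedge k l \<alpha> \<beta> x v = 0" if ij: "i < j" "j < k + l" "v i = v j" for v i j
  proof -
    let ?\<tau> = "Transposition.transpose i j"
    have \<tau>: "?\<tau> permutes {..<k + l}" using ij by (intro permutes_swap_id) auto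
    have v: "v (?\<tau> m) = v m" for m using ij by (simp add: Transposition.transpose_def)
    \<comment> \<open>Composing with the transposition of two equal arguments only flips the sign of
      each term, so the sum equals its own negative.\<close>
    have "sum (?T v) ?P = (\<Sum>\<sigma>\<in>?P. ?T v (?\<tau> \<circ> \<sigma>))"
      by (rule setum_permutations_compose_left[OF \<tau>])
    also have "\<dots> = (\<Sum>\<sigma>\<in>?P. - ?T v \<sigma>)"
    proof (rule sum.cong)
      fix \<sigma> assume "\<sigma> \<in> ?P"
      then have "sign (?\<tau> \<circ> \<sigma>) = - sign \<sigma>"
        using ij by (subst sign_compose)
          (auto simp: permutation_swap_id sign_swap_id intro: permutes_imp_permutation)
      then show "?T v (?\<tau> \<circ> \<sigma>) = - ?T v \<sigma>" by (simp add: v)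
    qed simp
    finally have "sum (?T v) ?P = 0" by (simp add: sum_negf)
    then show ?thesis unfolding wedge_def by simp
  qed
  ultimately show ?thesis unfolding alternating_def by blast
qed

lemma differential_form_wedge:
  assumes "open S" "differential_form k S \<alpha>" "differential_form l S \<beta>"
  shows "differential_form (k + l) S (wedge k l \<alpha> \<beta>)"
  using assms(2,3) unfolding differential_form_def
  by (auto intro!: alternating_wedge)
    (auto simp: wedge_def divide_inverse intro!: smooth_on_mult[OF assms(1)] smooth_on_sum[OF assms(1)] smooth_on_const)

lemma differential_form_scale:
  assumes "open S" "smooth_on S f" "differential_form k S \<omega>"
  shows "differential_form k S (scale_form f \<omega>)"
proof -
  have "linear (\<lambda>u. f x * \<omega> x (v(i := u)))" if "x \<in> S" "i < k" for x v i
    using assms(3) that linear_compose_scale_right[OF alternating_linear[of k "\<omega> x" i v], of "f x"]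
    by (auto simp: differential_form_def)
  then show ?thesis
    using assms unfolding differential_form_def scale_form_def
    by (auto simp: alternating_def intro: smooth_on_mult)
qed

lemma differential_form_wedge_power:
  assumes "open S" "differential_form k S \<omega>"
  shows "differential_form (k * m) S (wedge_power k \<omega> m)"
proof (induction m)
  case 0
  then show ?case
    by (simp add: differential_form_def function_form_def alternating_def smooth_on_const)
next
  case (Suc m)
  then show ?case using differential_form_wedge[OF assms] by simp
qed

text \<open>The Leibniz rule holds term by term in the sum over permutations: the directional part
  by the product rule, the part with the derivative of \<open>X\<close> because each changed
  argument falls into exactly one factor.\<close>

lemma lie_deriv_wedge:
  assumes \<alpha>: "alternating k (\<alpha> x)" "\<And>v. (\<lambda>y. \<alpha> y v) differentiable at x"
    and \<beta>: "alternating l (\<beta> x)" "\<And>v. (\<lambda>y. \<beta> y v) differentiable at x"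
  shows "lie_deriv (k + l) X (wedge k l \<alpha> \<beta>) x v =
    wedge k l (lie_deriv k X \<alpha>) \<beta> x v + wedge k l \<alpha> (lie_deriv l X \<beta>) x v"
proof -
  let ?P = "{\<sigma>. \<sigma> permutes {..<k + l}}"
  let ?N = "fact k * fact l :: real"
  let ?va = "\<lambda>\<sigma> i. v (\<sigma> i)"
  let ?vb = "\<lambda>\<sigma> j. v (\<sigma> (k + j))"
  let ?X' = "frechet_derivative X (at x)"
  let ?D\<alpha> = "\<lambda>v. frechet_derivative (\<lambda>y. \<alpha> y v) (at x) (X x)"
  let ?D\<beta> = "\<lambda>v. frechet_derivative (\<lambda>y. \<beta> y v) (at x) (X x)"
  have "frechet_derivative (\<lambda>y. wedge k l \<alpha> \<beta> y v) (at x) (X x) =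
    (\<Sum>\<sigma>\<in>?P. of_int (sign \<sigma>) * (?D\<alpha> (?va \<sigma>) * \<beta> x (?vb \<sigma>) + \<alpha> x (?va \<sigma>) * ?D\<beta> (?vb \<sigma>))) / ?N"
  proof -
    have D: "((\<lambda>y. \<alpha> y w) has_derivative frechet_derivative (\<lambda>y. \<alpha> y w) (at x)) (at x)"
      "((\<lambda>y. \<beta> y w) has_derivative frechet_derivative (\<lambda>y. \<beta> y w) (at x)) (at x)" for w
      using \<alpha>(2) \<beta>(2) by (simp_all add: frechet_derivative_works[symmetric])
    have "((\<lambda>y. of_int (sign \<sigma>) * \<alpha> y (?va \<sigma>) * \<beta> y (?vb \<sigma>)) has_derivative
      (\<lambda>u. of_int (sign \<sigma>) * (frechet_derivative (\<lambda>y. \<alpha> y (?va \<sigma>)) (at x) u * \<beta> x (?vb \<sigma>) +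
         \<alpha> x (?va \<sigma>) * frechet_derivative (\<lambda>y. \<beta> y (?vb \<sigma>)) (at x) u))) (at x)" for \<sigma>
      by (rule derivative_eq_intros D refl)+ (simp add: algebra_simps)
    then have "((\<lambda>y. wedge k l \<alpha> \<beta> y v) has_derivative (\<lambda>u.
      (\<Sum>\<sigma>\<in>?P. of_int (sign \<sigma>) * (frechet_derivative (\<lambda>y. \<alpha> y (?va \<sigma>)) (at x) u * \<beta> x (?vb \<sigma>) +
         \<alpha> x (?va \<sigma>) * frechet_derivative (\<lambda>y. \<beta> y (?vb \<sigma>)) (at x) u)) / ?N)) (at x)"
      unfolding wedge_def divide_inverse
      by (intro has_derivative_mult_left has_derivative_sum) auto
    from frechet_derivative_at[OF this, symmetric] show ?thesis by simp
  qed
  moreover have "(\<Sum>i<k + l. wedge k l \<alpha> \<beta> x (v(i := ?X' (v i)))) =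
    (\<Sum>\<sigma>\<in>?P. of_int (sign \<sigma>) *
       ((\<Sum>m<k. \<alpha> x ((?va \<sigma>)(m := ?X' (?va \<sigma> m)))) * \<beta> x (?vb \<sigma>) +
        \<alpha> x (?va \<sigma>) * (\<Sum>j<l. \<beta> x ((?vb \<sigma>)(j := ?X' (?vb \<sigma> j)))))) / ?N"
  proof -
    have "(\<Sum>i<k + l. \<alpha> x (\<lambda>m. (v(i := ?X' (v i))) (\<sigma> m)) * \<beta> x (\<lambda>j. (v(i := ?X' (v i))) (\<sigma> (k + j)))) =
        (\<Sum>m<k. \<alpha> x ((?va \<sigma>)(m := ?X' (?va \<sigma> m)))) * \<beta> x (?vb \<sigma>) +
        \<alpha> x (?va \<sigma>) * (\<Sum>j<l. \<beta> x ((?vb \<sigma>)(j := ?X' (?vb \<sigma> j))))" (is "sum ?t _ = ?r")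
      if \<sigma>: "\<sigma> permutes {..<k + l}" for \<sigma>
    proof -
      \<comment> \<open>Summing over positions after permuting, rather than over argument indices,
        separates the arguments of \<alpha> from those of \<beta>.\<close>
      have "sum ?t {..<k + l} = (\<Sum>m<k + l. ?t (\<sigma> m))"
        using sum.reindex_bij_betw[OF permutes_imp_bij[OF \<sigma>], of ?t] by simp
      also have "\<dots> = (\<Sum>m<k. ?t (\<sigma> m)) + (\<Sum>j<l. ?t (\<sigma> (k + j)))"
        by (rule sum_lessThan_add)
      also have "(\<Sum>m<k. ?t (\<sigma> m)) = (\<Sum>m<k. \<alpha> x ((?va \<sigma>)(m := ?X' (?va \<sigma> m))) * \<beta> x (?vb \<sigma>))"
      proof (rule sum.cong)
        fix m assume "m \<in> {..<k}"
        moreover have "(\<lambda>m'. (v(\<sigma> m := u)) (\<sigma> m')) = (?va \<sigma>)(m := u)" for u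
          using permutes_fun_upd[OF \<sigma>, of v m u "\<lambda>j. j"] by (simp add: fun_upd_def)
        ultimately show "?t (\<sigma> m) = \<alpha> x ((?va \<sigma>)(m := ?X' (?va \<sigma> m))) * \<beta> x (?vb \<sigma>)"
          using permutes_fun_upd[OF \<sigma>, of v m _ "\<lambda>j. k + j"] by simp
      qed simp
      also have "(\<Sum>j<l. ?t (\<sigma> (k + j))) = (\<Sum>j<l. \<alpha> x (?va \<sigma>) * \<beta> x ((?vb \<sigma>)(j := ?X' (?vb \<sigma> j))))"
      proof (rule sum.cong)
        fix j
        have "(\<lambda>j'. (v(\<sigma> (k + j) := u)) (\<sigma> (k + j'))) = (?vb \<sigma>)(j := u)" for u
          using permutes_fun_upd[OF \<sigma>, of v "k + j" u "\<lambda>j. k + j"] by (simp add: fun_upd_def)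
        \<comment> \<open>The changed entry sits at position \<open>k + j\<close>, beyond the first
          \<open>k\<close> entries that \<alpha> reads.\<close>
        moreover have "\<alpha> x (\<lambda>m'. (v(\<sigma> (k + j) := u)) (\<sigma> m')) = \<alpha> x (?va \<sigma>)" for u
          using fun_cong[OF permutes_fun_upd[OF \<sigma>, of v "k + j" u "\<lambda>j. j"]]
          by (intro alternating_cong[OF \<alpha>(1)]) simp
        ultimately show "?t (\<sigma> (k + j)) = \<alpha> x (?va \<sigma>) * \<beta> x ((?vb \<sigma>)(j := ?X' (?vb \<sigma> j)))"
          by simp
      qed simp
      finally show ?thesis by (simp only: sum_distrib_left sum_distrib_right)
    qed
    then have "(\<Sum>\<sigma>\<in>?P. of_int (sign \<sigma>) *
       ((\<Sum>m<k. \<alpha> x ((?va \<sigma>)(m := ?X' (?va \<sigma> m)))) * \<beta> x (?vb \<sigma>) +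
        \<alpha> x (?va \<sigma>) * (\<Sum>j<l. \<beta> x ((?vb \<sigma>)(j := ?X' (?vb \<sigma> j)))))) =
      (\<Sum>\<sigma>\<in>?P. \<Sum>i<k + l. of_int (sign \<sigma>) * \<alpha> x (\<lambda>m. (v(i := ?X' (v i))) (\<sigma> m)) *
         \<beta> x (\<lambda>j. (v(i := ?X' (v i))) (\<sigma> (k + j))))"
      by (intro sum.cong refl) (simp add: sum_distrib_left[symmetric] mult.assoc)
    then show ?thesis
      unfolding wedge_def by (subst (asm) sum.swap) (simp add: sum_divide_distrib[symmetric])
  qed
  ultimately show ?thesis
    unfolding lie_deriv_def
    by (simp add: wedge_def add_divide_distrib[symmetric] sum.distrib[symmetric] algebra_simps)
qed

text \<open>Eigenvalues of a derivation add under products, which lets the volume form be treated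
  without expanding it.\<close>

lemma lie_deriv_wedge_eigen:
  assumes "alternating k (\<alpha> x)" "\<And>v. (\<lambda>y. \<alpha> y v) differentiable at x"
    and "alternating l (\<beta> x)" "\<And>v. (\<lambda>y. \<beta> y v) differentiable at x"
    and "\<And>v. lie_deriv k X \<alpha> x v = a * \<alpha> x v" "\<And>v. lie_deriv l X \<beta> x v = b * \<beta> x v"
  shows "lie_deriv (k + l) X (wedge k l \<alpha> \<beta>) x v = (a + b) * wedge k l \<alpha> \<beta> x v"
  unfolding lie_deriv_wedge[where \<alpha> = \<alpha> and \<beta> = \<beta>, OF assms(1-4)]
  unfolding wedge_def assms(5,6)
  by (simp add: add_divide_distrib[symmetric] sum.distrib[symmetric] sum_distrib_left algebra_simps)

lemma lie_deriv_scale: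
  assumes "f differentiable at x" "(\<lambda>y. \<omega> y v) differentiable at x"
  shows "lie_deriv k X (scale_form f \<omega>) x v =
    frechet_derivative f (at x) (X x) * \<omega> x v + f x * lie_deriv k X \<omega> x v"
  by (simp add: lie_deriv_def scale_form_def frechet_derivative_mult_at[OF assms]
      sum_distrib_left[symmetric] algebra_simps)

lemma differential_form_differentiable:
  "differential_form k S \<omega> \<Longrightarrow> x \<in> S \<Longrightarrow> (\<lambda>y. \<omega> y v) differentiable at x"
  unfolding differential_form_def using smooth_onD by blast

lemma differential_form_alternating:
  "differential_form k S \<omega> \<Longrightarrow> x \<in> S \<Longrightarrow> alternating k (\<omega> x)"
  unfolding differential_form_def by blast

lemma lie_deriv_wedge_power_eigen:
  assumes "open S" "differential_form k S \<omega>" "x \<in> S" "\<And>v. lie_deriv k X \<omega> x v = a * \<omega> x v"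
  shows "lie_deriv (k * m) X (wedge_power k \<omega> m) x v = (real m * a) * wedge_power k \<omega> m x v"
proof (induction m arbitrary: v)
  case 0
  then show ?case by (simp add: lie_deriv_def function_form_def)
next
  case (Suc m)
  note form = differential_form_wedge_power[OF assms(1,2), of m]
  have "lie_deriv (k + k * m) X (wedge k (k * m) \<omega> (wedge_power k \<omega> m)) x v =
      (a + real m * a) * wedge k (k * m) \<omega> (wedge_power k \<omega> m) x v"
    by (rule lie_deriv_wedge_eigen)
      (use assms Suc.IH form in \<open>auto intro: differential_form_alternating differential_form_differentiable\<close>)
  then show ?case by (simp add: algebra_simps)
qed

section \<open>Contact Hamiltonian vector fields\<close>

lemma differentiable_transform_open:
  assumes "f differentiable at x" "open S" "x \<in> S" "\<And>y. y \<in> S \<Longrightarrow> f y = g y"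
  shows "g differentiable at x"
  using assms has_derivative_transform_within_open unfolding differentiable_def by metis

text \<open>Allows both sides of an identity on an open set to be differentiated, as is done below
  with the defining equations of \<open>X\<close>.\<close>

lemma has_derivative_unique_on_open:
  assumes "open S" "c \<in> S" "(f has_derivative f') (at c)" "(g has_derivative g') (at c)"
    and "\<And>y. y \<in> S \<Longrightarrow> f y = g y"
  shows "f' u = g' u"
  using has_derivative_unique[OF has_derivative_transform_within_open[OF assms(3,1,2,5)] assms(4)]
  by metis

text \<open>The bilinear part of the contact form: \<open>\<lambda>\<close> at \<open>c\<close> is
  \<open>z_coord v - momentum_pairing c v\<close>. As this is affine in \<open>c\<close>,
  \<open>d\<lambda>\<close> is the antisymmetrised pairing and does not depend on the point.\<close>

definition momentum_pairing :: "'n::finite phase \<Rightarrow> 'n phase \<Rightarrow> real" where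
  "momentum_pairing u v = p_coord u \<bullet> x_coord v + plast_coord u * xlast_coord v"

lemma bounded_linear_coords:
  "bounded_linear x_coord" "bounded_linear xlast_coord" "bounded_linear p_coord"
  "bounded_linear plast_coord" "bounded_linear z_coord"
proof -
  note coords = x_coord_def[abs_def] xlast_coord_def[abs_def] p_coord_def[abs_def]
    plast_coord_def[abs_def] z_coord_def[abs_def]
  show "bounded_linear x_coord" "bounded_linear xlast_coord" "bounded_linear p_coord"
    "bounded_linear plast_coord" "bounded_linear z_coord"
    unfolding coords
    by (intro bounded_linear_compose[OF bounded_linear_fst] bounded_linear_compose[OF bounded_linear_snd]
        bounded_linear_fst bounded_linear_snd bounded_linear_ident)+
qed

lemma coords_add_scaleR [simp]:
  "x_coord (u + v) = x_coord u + x_coord v" "x_coord (r *\<^sub>R v) = r *\<^sub>R x_coord v"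
  "xlast_coord (u + v) = xlast_coord u + xlast_coord v" "xlast_coord (r *\<^sub>R v) = r * xlast_coord v"
  "p_coord (u + v) = p_coord u + p_coord v" "p_coord (r *\<^sub>R v) = r *\<^sub>R p_coord v"
  "plast_coord (u + v) = plast_coord u + plast_coord v" "plast_coord (r *\<^sub>R v) = r * plast_coord v"
  "z_coord (u + v) = z_coord u + z_coord v" "z_coord (r *\<^sub>R v) = r * z_coord v"
  by (simp_all add: x_coord_def xlast_coord_def p_coord_def plast_coord_def z_coord_def)

lemma coords_tuple [simp]:
  "x_coord (x, y, p, q, z) = x" "xlast_coord (x, y, p, q, z) = y" "p_coord (x, y, p, q, z) = p"
  "plast_coord (x, y, p, q, z) = q" "z_coord (x, y, p, q, z) = z"
  by (simp_all add: x_coord_def xlast_coord_def p_coord_def plast_coord_def z_coord_def)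

lemma bounded_bilinear_momentum_pairing: "bounded_bilinear momentum_pairing"
  unfolding bilinear_conv_bounded_bilinear[symmetric] bilinear_def momentum_pairing_def
  by (auto intro!: linearI simp: inner_simps algebra_simps)

lemma canonical_contact_form_eq:
  "canonical_contact_form c v = z_coord (v 0) - momentum_pairing c (v 0)"
  by (simp add: canonical_contact_form_def momentum_pairing_def inner_vec_def)

lemma canonical_contact_form_has_derivative:
  "((\<lambda>c. canonical_contact_form c v) has_derivative (\<lambda>u. - momentum_pairing u (v 0))) (at c)"
proof -
  have "((\<lambda>c. z_coord (v 0) - momentum_pairing c (v 0)) has_derivative
      (\<lambda>u. 0 - momentum_pairing u (v 0))) (at c)"
    by (intro has_derivative_diff has_derivative_const bounded_linear_imp_has_derivative
        bounded_bilinear.bounded_linear_left[OF bounded_bilinear_momentum_pairing])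
  then show ?thesis by (simp add: canonical_contact_form_eq)
qed

lemma ext_deriv_canonical_contact_form:
  "ext_deriv 1 canonical_contact_form = (\<lambda>c v. momentum_pairing (v 1) (v 0) - momentum_pairing (v 0) (v 1))"
proof (intro ext)
  fix c and v :: "nat \<Rightarrow> 'a phase"
  have D: "frechet_derivative (\<lambda>c. canonical_contact_form c w) (at c) u = - momentum_pairing u (w 0)"
    for w :: "nat \<Rightarrow> 'a phase" and u
    using canonical_contact_form_has_derivative[THEN frechet_derivative_at] by metis
  show "ext_deriv 1 canonical_contact_form c v = momentum_pairing (v 1) (v 0) - momentum_pairing (v 0) (v 1)"
    by (simp add: ext_deriv_def D)
qed

lemma differential_form_canonical_contact_form:
  assumes "open S"
  shows "differential_form 1 S canonical_contact_form"
proof -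
  interpret bounded_bilinear momentum_pairing by (rule bounded_bilinear_momentum_pairing)
  have "smooth_on S (\<lambda>c. canonical_contact_form c v)" for v :: "nat \<Rightarrow> 'a phase"
    unfolding canonical_contact_form_eq
    by (intro smooth_on_diff assms smooth_on_const smooth_on_linear bounded_linear_left)
  moreover have "linear (\<lambda>u. canonical_contact_form c (v(0 := u)))" for c and v :: "nat \<Rightarrow> 'a phase"
    by (rule linearI) (simp_all add: canonical_contact_form_eq algebra_simps add_right scaleR_right)
  then have "alternating 1 (canonical_contact_form c)" for c :: "'a phase"
    by (auto simp: alternating_def canonical_contact_form_eq)
  ultimately show ?thesis by (simp add: differential_form_def)
qed

lemma differential_form_ext_deriv_canonical_contact_form:
  "differential_form 2 S (ext_deriv 1 canonical_contact_form)"
proof -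
  interpret bounded_bilinear momentum_pairing by (rule bounded_bilinear_momentum_pairing)
  let ?\<omega> = "\<lambda>v :: nat \<Rightarrow> 'a phase. momentum_pairing (v 1) (v 0) - momentum_pairing (v 0) (v 1)"
  have "linear (\<lambda>u. ?\<omega> (v(0 := u)))" "linear (\<lambda>u. ?\<omega> (v(1 := u)))" for v
    by (rule linearI; simp add: add_left add_right scaleR_left scaleR_right right_diff_distrib)+
  then have "alternating 2 ?\<omega>"
    by (auto simp: alternating_def less_2_cases_iff)
  then show ?thesis
    unfolding ext_deriv_canonical_contact_form differential_form_def
    by (simp add: smooth_on_const)
qed

lemma phase_map_differentiable:
  fixes X :: "'a::euclidean_space \<Rightarrow> 'n::finite phase"
  assumes "\<And>a. (\<lambda>c. x_coord (X c) $ a) differentiable at c" "(\<lambda>c. xlast_coord (X c)) differentiable at c"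
    "\<And>a. (\<lambda>c. p_coord (X c) $ a) differentiable at c" "(\<lambda>c. plast_coord (X c)) differentiable at c"
    "(\<lambda>c. z_coord (X c)) differentiable at c"
  shows "X differentiable at c"
proof -
  have vec: "g differentiable at c" if "\<And>a. (\<lambda>c. g c $ a) differentiable at c" for g :: "'a \<Rightarrow> real ^ 'n"
  proof -
    have "(\<lambda>c. \<Sum>a\<in>UNIV. (g c $ a) *\<^sub>R (axis a 1 :: real ^ 'n)) differentiable at c"
      using that by (intro differentiable_sum differentiable_scaleR) auto
    moreover have "(\<lambda>c. \<Sum>a\<in>UNIV. (g c $ a) *\<^sub>R (axis a 1 :: real ^ 'n)) = g"
      using basis_expansion[of "g _"] by (intro ext) (simp add: scalar_mult_eq_scaleR)
    ultimately show ?thesis by simp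
  qed
  have Pair: "(\<lambda>c. (f c, g c)) differentiable at c" if "f differentiable at c" "g differentiable at c"
    for f :: "'a \<Rightarrow> 'b::real_normed_vector" and g :: "'a \<Rightarrow> 'c::real_normed_vector"
    using that has_derivative_Pair unfolding differentiable_def by blast
  have "(\<lambda>c. (x_coord (X c), xlast_coord (X c), p_coord (X c), plast_coord (X c), z_coord (X c)))
      differentiable at c"
    by (intro Pair vec assms)
  then show ?thesis
    by (simp add: x_coord_def xlast_coord_def p_coord_def plast_coord_def z_coord_def)
qed

section \<open>Consequences of the two defining equations of a contact Hamiltonian field\<close>

context
  fixes C :: "'n::finite phase set" and h :: "'n phase \<Rightarrow> real" and X :: "'n phase \<Rightarrow> 'n phase"
  assumes C: "open C" and h: "smooth_on C h"
    and X: "contact_hamiltonian_vector_field C canonical_contact_form h X"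
begin

interpretation pairing: bounded_bilinear momentum_pairing
  by (rule bounded_bilinear_momentum_pairing)

lemma contact_form_hamiltonian_field:
  assumes "c \<in> C"
  shows "z_coord (X c) - momentum_pairing c (X c) = h c"
  using X assms
  by (simp add: contact_hamiltonian_vector_field_def interior_product_def canonical_contact_form_eq)

lemma ext_deriv_hamiltonian_field:
  assumes "c \<in> C"
  shows "momentum_pairing u (X c) - momentum_pairing (X c) u =
    - (frechet_derivative h (at c) u - d_dz h c * (z_coord u - momentum_pairing c u))"
proof -
  have "interior_product X (ext_deriv 1 canonical_contact_form) c (\<lambda>_. u) =
      - (ext_deriv 0 (function_form h) c (\<lambda>_. u) - d_dz h c * canonical_contact_form c (\<lambda>_. u))"
    using X assms unfolding contact_hamiltonian_vector_field_def by blast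
  then show ?thesis
    unfolding ext_deriv_canonical_contact_form
    by (simp add: interior_product_def canonical_contact_form_eq ext_deriv_def function_form_def)
qed

text \<open>Inserting \<open>X\<close> itself into the second equation kills the antisymmetric left
  side, and \<open>\<lambda>(X) = h\<close> turns what remains into the rate of change of
  \<open>h\<close>.\<close>

lemma hamiltonian_along_field:
  assumes "c \<in> C"
  shows "frechet_derivative h (at c) (X c) = d_dz h c * h c"
  using ext_deriv_hamiltonian_field[OF assms, of "X c"] contact_form_hamiltonian_field[OF assms] by simp

text \<open>Testing the second equation on coordinate vectors yields Hamilton's equations:
  p-directions give the x-components of \<open>X\<close> and conversely. The z-component then
  follows from \<open>\<lambda>(X) = h\<close>. All right-hand sides are differentiable because
  \<open>h\<close> is smooth.\<close>

lemma hamiltonian_field_differentiable: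
  assumes c: "c \<in> C"
  shows "X differentiable at c"
proof -
  let ?d = "\<lambda>u y. frechet_derivative h (at y) u"
  have d: "?d u differentiable at c" for u
    using smooth_onD[OF smooth_on_frechet_derivative[OF h] c] .
  have dz: "d_dz h differentiable at c"
    unfolding d_dz_def[abs_def] by (rule d)
  have coord: "(\<lambda>y. L y) differentiable at c" if "bounded_linear L" for L :: "'n phase \<Rightarrow> 'b::real_normed_vector"
    using bounded_linear_imp_differentiable[OF that] .
  have pa: "(\<lambda>y. p_coord y $ a) differentiable at c" for a
    by (intro coord bounded_linear_compose[OF bounded_linear_vec_nth] bounded_linear_coords)
  have x: "(\<lambda>y. x_coord (X y) $ a) differentiable at c" for a
  proof (rule differentiable_transform_open[OF _ C c])
    show "(\<lambda>y. - ?d (0, 0, axis a 1, 0, 0) y) differentiable at c"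
      using d by simp
    show "- ?d (0, 0, axis a 1, 0, 0) y = x_coord (X y) $ a" if "y \<in> C" for y
      using ext_deriv_hamiltonian_field[OF that, of "(0, 0, axis a 1, 0, 0)"]
      by (simp add: momentum_pairing_def inner_axis inner_commute)
  qed
  have xl: "(\<lambda>y. xlast_coord (X y)) differentiable at c"
  proof (rule differentiable_transform_open[OF _ C c])
    show "(\<lambda>y. - ?d (0, 0, 0, 1, 0) y) differentiable at c"
      using d by simp
    show "- ?d (0, 0, 0, 1, 0) y = xlast_coord (X y)" if "y \<in> C" for y
      using ext_deriv_hamiltonian_field[OF that, of "(0, 0, 0, 1, 0)"]
      by (simp add: momentum_pairing_def)
  qed
  have p: "(\<lambda>y. p_coord (X y) $ a) differentiable at c" for a
  proof (rule differentiable_transform_open[OF _ C c])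
    show "(\<lambda>y. ?d (axis a 1, 0, 0, 0, 0) y + d_dz h y * p_coord y $ a) differentiable at c"
      using d dz pa by simp
    show "?d (axis a 1, 0, 0, 0, 0) y + d_dz h y * p_coord y $ a = p_coord (X y) $ a" if "y \<in> C" for y
      using ext_deriv_hamiltonian_field[OF that, of "(axis a 1, 0, 0, 0, 0)"]
      by (simp add: momentum_pairing_def inner_axis)
  qed
  have pl: "(\<lambda>y. plast_coord (X y)) differentiable at c"
  proof (rule differentiable_transform_open[OF _ C c])
    show "(\<lambda>y. ?d (0, 1, 0, 0, 0) y + d_dz h y * plast_coord y) differentiable at c"
      using d dz coord[OF bounded_linear_coords(4)] by simp
    show "?d (0, 1, 0, 0, 0) y + d_dz h y * plast_coord y = plast_coord (X y)" if "y \<in> C" for y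
      using ext_deriv_hamiltonian_field[OF that, of "(0, 1, 0, 0, 0)"]
      by (simp add: momentum_pairing_def)
  qed
  have z: "(\<lambda>y. z_coord (X y)) differentiable at c"
  proof (rule differentiable_transform_open[OF _ C c])
    show "(\<lambda>y. h y + ((\<Sum>a\<in>UNIV. p_coord y $ a * x_coord (X y) $ a) + plast_coord y * xlast_coord (X y)))
        differentiable at c"
      using smooth_onD[OF h c] pa x xl coord[OF bounded_linear_coords(4)] by simp
    show "h y + ((\<Sum>a\<in>UNIV. p_coord y $ a * x_coord (X y) $ a) + plast_coord y * xlast_coord (X y)) =
        z_coord (X y)" if "y \<in> C" for y
      using contact_form_hamiltonian_field[OF that]
      by (simp add: momentum_pairing_def inner_vec_def)
  qed
  show ?thesis by (rule phase_map_differentiable[OF x xl p pl z])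
qed

lemma hamiltonian_field_has_derivative:
  "c \<in> C \<Longrightarrow> (X has_derivative frechet_derivative X (at c)) (at c)"
  using hamiltonian_field_differentiable by (simp add: frechet_derivative_works)

text \<open>Cartan's formula by hand: differentiating \<open>\<lambda>(X) = h\<close> expresses
  \<open>\<lambda>\<close> of the derivative of \<open>X\<close>, and the differential of
  \<open>h\<close> then cancels against the one in the second equation.\<close>

lemma lie_deriv_contact_form:
  assumes c: "c \<in> C"
  shows "lie_deriv 1 X canonical_contact_form c v = d_dz h c * canonical_contact_form c v"
proof -
  let ?X' = "frechet_derivative X (at c)"
  have "((\<lambda>y. z_coord (X y) - momentum_pairing y (X y)) has_derivative
      (\<lambda>u. z_coord (?X' u) - (momentum_pairing c (?X' u) + momentum_pairing u (X c)))) (at c)"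
    by (intro has_derivative_diff pairing.FDERIV has_derivative_ident
        bounded_linear.has_derivative[OF bounded_linear_coords(5)] hamiltonian_field_has_derivative[OF c])
  from has_derivative_unique_on_open[OF C c this smooth_on_has_derivative[OF h c] contact_form_hamiltonian_field]
  have "z_coord (?X' (v 0)) - (momentum_pairing c (?X' (v 0)) + momentum_pairing (v 0) (X c)) =
      frechet_derivative h (at c) (v 0)" by simp
  then show ?thesis
    using ext_deriv_hamiltonian_field[OF c, of "v 0"]
      canonical_contact_form_has_derivative[of v c, THEN frechet_derivative_at, symmetric]
    by (simp add: lie_deriv_def canonical_contact_form_eq)
qed

text \<open>In general the Lie derivative of \<open>d\<lambda>\<close> is \<open>d(\<partial>h/\<partial>z \<lambda>)\<close>, which is a multiple of \<open>d\<lambda>\<close> only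
  because \<open>\<partial>h/\<partial>z\<close> is constant.\<close>

lemma lie_deriv_ext_deriv_contact_form:
  assumes k: "\<And>y. y \<in> C \<Longrightarrow> d_dz h y = k" and c: "c \<in> C"
  shows "lie_deriv 2 X (ext_deriv 1 canonical_contact_form) c v =
    k * ext_deriv 1 canonical_contact_form c v"
proof -
  let ?X' = "frechet_derivative X (at c)"
  let ?D2 = "\<lambda>u w. frechet_derivative (\<lambda>y. frechet_derivative h (at y) w) (at c) u"
  \<comment> \<open>The second equation with \<open>w\<close> held fixed, differentiated in
    direction \<open>u\<close>; the constancy of \<open>d_dz h\<close> leaves no derivative of that
    coefficient.\<close>
  have DX: "momentum_pairing w (?X' u) - momentum_pairing (?X' u) w =
      - (?D2 u w - k * (0 - momentum_pairing u w))" for u w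
  proof -
    have L: "((\<lambda>y. momentum_pairing w (X y) - momentum_pairing (X y) w) has_derivative
        (\<lambda>u. momentum_pairing w (?X' u) - momentum_pairing (?X' u) w)) (at c)"
      by (intro has_derivative_diff bounded_linear.has_derivative[OF pairing.bounded_linear_left]
          bounded_linear.has_derivative[OF pairing.bounded_linear_right] hamiltonian_field_has_derivative[OF c])
    have R: "((\<lambda>y. - (frechet_derivative h (at y) w - k * (z_coord w - momentum_pairing y w))) has_derivative
        (\<lambda>u. - (?D2 u w - k * (0 - momentum_pairing u w)))) (at c)"
      by (intro has_derivative_minus has_derivative_diff has_derivative_mult_right has_derivative_const
          bounded_linear.has_derivative[OF pairing.bounded_linear_left] has_derivative_ident
          smooth_on_has_derivative[OF smooth_on_frechet_derivative[OF h] c])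
    show ?thesis
      by (rule has_derivative_unique_on_open[OF C c L R]) (use ext_deriv_hamiltonian_field k in simp)
  qed
  \<comment> \<open>The two arguments of \<open>d\<lambda>\<close> contribute second derivatives of
    \<open>h\<close> with opposite signs and exchanged directions, so symmetry removes them.\<close>
  have "?D2 (v 0) (v 1) = ?D2 (v 1) (v 0)"
    by (rule smooth_on_mixed_derivatives_commute[OF C h c])
  then show ?thesis
    using DX[of "v 1" "v 0"] DX[of "v 0" "v 1"]
    unfolding lie_deriv_def ext_deriv_canonical_contact_form
    by (simp add: numeral_2_eq_2 algebra_simps)
qed

text \<open>One factor \<open>k\<close> comes from \<open>\<lambda>\<close> and one from each of the
  \<open>m\<close> copies of \<open>d\<lambda>\<close>; \<open>m = n + 1\<close> is the origin of
  \<open>n + 2\<close>.\<close>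

lemma lie_deriv_contact_volume:
  assumes k: "\<And>y. y \<in> C \<Longrightarrow> d_dz h y = k" and c: "c \<in> C"
  shows "lie_deriv (1 + 2 * m) X (contact_volume m canonical_contact_form) c v =
    real (m + 1) * k * contact_volume m canonical_contact_form c v"
proof -
  let ?\<omega> = "ext_deriv 1 canonical_contact_form :: 'n phase form"
  note forms = differential_form_canonical_contact_form[OF C]
    differential_form_wedge_power[OF C differential_form_ext_deriv_canonical_contact_form, of m]
  have "lie_deriv (1 + 2 * m) X (wedge 1 (2 * m) canonical_contact_form (wedge_power 2 ?\<omega> m)) c v =
    (k + real m * k) * wedge 1 (2 * m) canonical_contact_form (wedge_power 2 ?\<omega> m) c v"
  proof (rule lie_deriv_wedge_eigen)
    show "lie_deriv 1 X canonical_contact_form c v = k * canonical_contact_form c v" for v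
      using lie_deriv_contact_form[OF c] k[OF c] by simp
    show "lie_deriv (2 * m) X (wedge_power 2 ?\<omega> m) c v = real m * k * wedge_power 2 ?\<omega> m c v" for v
      by (intro lie_deriv_wedge_power_eigen[OF C differential_form_ext_deriv_canonical_contact_form c]
          lie_deriv_ext_deriv_contact_form k c)
  qed (use forms c in \<open>auto intro: differential_form_alternating differential_form_differentiable\<close>)
  then show ?thesis by (simp add: contact_volume_def algebra_simps)
qed

end

lemma differential_form_contact_volume:
  "open S \<Longrightarrow> differential_form (1 + 2 * m) S (contact_volume m canonical_contact_form)"
  unfolding contact_volume_def
  by (intro differential_form_wedge differential_form_canonical_contact_form
      differential_form_wedge_power differential_form_ext_deriv_canonical_contact_form)

section \<open>Invariant densities\<close>

lemma smooth_on_model_hamiltonian: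
  fixes C :: "'n::finite phase set"
  assumes "open C" "smooth_on (p_coord ` C) \<phi>" "\<And>a. smooth_on (p_coord ` C) (F a)"
  shows "smooth_on C (model_hamiltonian \<phi> F x0 \<gamma>)"
proof -
  have p: "smooth_on C (\<lambda>c. f (p_coord c))" if "smooth_on (p_coord ` C) f" for f
    by (rule smooth_on_compose_linear[OF assms(1) bounded_linear_coords(3) that])
  have "smooth_on C (\<lambda>c. \<phi> (p_coord c))" "smooth_on C (\<lambda>c. F a (p_coord c))"
    "smooth_on C (\<lambda>c. frechet_derivative \<phi> (at (p_coord c)) v)" for a v
    by (intro p smooth_on_frechet_derivative assms(2,3))+
  moreover have "smooth_on C (\<lambda>c. x_coord c $ a)" "smooth_on C (\<lambda>c. p_coord c $ a)" for a
    by (intro smooth_on_linear bounded_linear_compose[OF bounded_linear_vec_nth] bounded_linear_coords)+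
  moreover have "smooth_on C xlast_coord" "smooth_on C plast_coord" "smooth_on C z_coord"
    by (intro smooth_on_linear bounded_linear_coords)+
  ultimately show ?thesis
    unfolding model_hamiltonian_def[abs_def] d_dp_def divide_inverse
    by (intro smooth_on_add[OF assms(1)] smooth_on_diff[OF assms(1)] smooth_on_mult[OF assms(1)]
        smooth_on_sum[OF assms(1)] smooth_on_const)
qed

text \<open>This exact shift gives both the constant z-derivative of \<open>h\<close> and a line
  through every point on which \<open>h\<close> attains each real value once if
  \<open>\<gamma>\<close> is nonzero.\<close>

lemma model_hamiltonian_z_shift:
  "model_hamiltonian \<phi> F x0 \<gamma> (c + s *\<^sub>R (0, 0, 0, 0, 1)) = model_hamiltonian \<phi> F x0 \<gamma> c - \<gamma> * s"
  by (simp add: model_hamiltonian_def algebra_simps)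

lemma affine_on_line_frechet_derivative:
  fixes h :: "'a::euclidean_space \<Rightarrow> real"
  assumes "h differentiable at c" "\<And>s. h (c + s *\<^sub>R e) = h c + k * s"
  shows "frechet_derivative h (at c) e = k"
proof -
  have "((\<lambda>s. h (c + s *\<^sub>R e)) has_derivative (\<lambda>s. frechet_derivative h (at c) (s *\<^sub>R e))) (at 0)"
    by (rule has_derivative_compose[where g = h and f = "\<lambda>s. c + s *\<^sub>R e"])
      (use assms(1) in \<open>auto intro!: derivative_eq_intros simp: frechet_derivative_works[symmetric]\<close>)
  moreover have "((\<lambda>s. h (c + s *\<^sub>R e)) has_derivative (\<lambda>s. k * s)) (at 0)"
    unfolding assms(2) by (auto intro!: derivative_eq_intros)
  ultimately have "(\<lambda>s. frechet_derivative h (at c) (s *\<^sub>R e)) = (\<lambda>s. k * s)"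
    by (rule has_derivative_unique)
  then show ?thesis by (metis mult.right_neutral scaleR_one)
qed

lemma has_derivative_real_compose:
  fixes h :: "'a::euclidean_space \<Rightarrow> real"
  assumes "h differentiable at c" "(g has_real_derivative d) (at (h c))"
  shows "((\<lambda>y. g (h y)) has_derivative (\<lambda>u. d * frechet_derivative h (at c) u)) (at c)"
  using has_derivative_compose[of h _ c UNIV g "(*) d"] assms
  by (simp add: frechet_derivative_works[symmetric] has_field_derivative_def)

text \<open>Along the flow both \<open>h\<close> and a density \<open>g \<circ> h\<close> scale exponentially, which is an Euler
  equation for \<open>g\<close> because the lines in direction \<open>e\<close> are transversal to the level sets of \<open>h\<close>.\<close>

lemma euler_equation_of_density:
  fixes h f :: "'a::euclidean_space \<Rightarrow> real"
  assumes R: "open R" "c \<in> R" and \<gamma>: "\<gamma> \<noteq> 0"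
    and h: "h differentiable at c" "\<And>s. h (c + s *\<^sub>R e) = h c - \<gamma> * s"
    and f: "f differentiable at c" "\<And>y. y \<in> R \<Longrightarrow> f y = g (h y)"
    and hw: "frechet_derivative h (at c) w = - \<gamma> * h c"
    and fw: "frechet_derivative f (at c) w = N * \<gamma> * f c"
  obtains d where "(g has_real_derivative d) (at (h c))" "d * h c = - N * g (h c)"
proof -
  \<comment> \<open>The point of the line through \<open>c\<close> at which \<open>h\<close> takes
    the value \<open>t\<close>. Near \<open>h c\<close> it stays in the open set \<open>R\<close>,
    so there \<open>g\<close> equals \<open>f \<circ> l\<close> and inherits differentiability from
    \<open>f\<close>.\<close>
  define l where "l = (\<lambda>t. c + ((h c - t) / \<gamma>) *\<^sub>R e)"
  have l: "l (h c) = c" "h (l t) = t" for t using \<gamma> by (simp_all add: l_def h(2))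
  have "continuous_on UNIV l" unfolding l_def by (intro continuous_intros) (use \<gamma> in auto)
  then have T: "open (l -` R)" using R(1) open_vimage by blast
  have "((\<lambda>t. f (l t)) has_derivative (\<lambda>s. frechet_derivative f (at c) ((- s / \<gamma>) *\<^sub>R e))) (at (h c))"
  proof (rule has_derivative_compose[where g = f and f = l])
    show "(l has_derivative (\<lambda>s. (- s / \<gamma>) *\<^sub>R e)) (at (h c))"
      unfolding l_def using \<gamma> by (auto intro!: derivative_eq_intros)
    show "(f has_derivative frechet_derivative f (at c)) (at (l (h c)))"
      using f(1) by (simp add: l frechet_derivative_works[symmetric])
  qed
  moreover have "frechet_derivative f (at c) ((- s / \<gamma>) *\<^sub>R e) = (- frechet_derivative f (at c) e / \<gamma>) * s" for s
    using linear_scale[OF linear_frechet_derivative[OF f(1)], of "- s / \<gamma>" e] by simp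
  ultimately have "((\<lambda>t. f (l t)) has_real_derivative (- frechet_derivative f (at c) e / \<gamma>)) (at (h c))"
    by (simp only: has_field_derivative_def)
  then have g: "(g has_real_derivative (- frechet_derivative f (at c) e / \<gamma>)) (at (h c))"
    by (rule has_field_derivative_transform_within_open[OF _ T]) (use R l f(2) in auto)
  define d where "d = - frechet_derivative f (at c) e / \<gamma>"
  \<comment> \<open>With \<open>g\<close> now differentiable at \<open>h c\<close>, the chain rule
    gives a second value for the derivative of \<open>f\<close> along \<open>w\<close>; comparing it
    with \<open>fw\<close> yields the Euler equation.\<close>
  have "(f has_derivative (\<lambda>u. d * frechet_derivative h (at c) u)) (at c)"
    by (rule has_derivative_transform_within_open[OF has_derivative_real_compose[OF h(1) g[folded d_def]] R])
      (use f(2) in simp)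
  from frechet_derivative_at[OF this] have "frechet_derivative f (at c) w = d * (- \<gamma> * h c)"
    using hw by metis
  then have "\<gamma> * (d * h c) = \<gamma> * (- N * g (h c))"
    using fw f(2)[OF R(2)] by (simp add: algebra_simps)
  then have "d * h c = - N * g (h c)" using \<gamma> by (simp only: mult_cancel_left) simp
  with g show thesis using that unfolding d_def by blast
qed

text \<open>The Euler equation says that \<open>g t * t ^ N\<close> has zero derivative, so this
  product is constant on the connected set \<open>I\<close>.\<close>

lemma euler_equation_homogeneous:
  fixes g :: "real \<Rightarrow> real"
  assumes I: "open I" "connected I" "I \<subseteq> {0<..}"
    and g: "\<And>t. t \<in> I \<Longrightarrow> \<exists>d. (g has_real_derivative d) (at t) \<and> d * t = - real N * g t"
  obtains K where "\<And>t. t \<in> I \<Longrightarrow> g t = K * inverse t ^ N"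
proof -
  have D: "((\<lambda>t. g t * t ^ N) has_real_derivative 0) (at t)" if "t \<in> I" for t
  proof -
    obtain d where d: "(g has_real_derivative d) (at t)" "d * t = - real N * g t" using g[OF \<open>t \<in> I\<close>] by blast
    have "((\<lambda>t. g t * t ^ N) has_real_derivative (d * t ^ N + real N * t ^ (N - 1) * g t)) (at t)"
      using d(1) by (auto intro!: derivative_eq_intros)
    moreover have "d * t ^ N + real N * t ^ (N - 1) * g t = 0"
    proof (cases N)
      \<comment> \<open>Here \<open>N - 1\<close> is truncated to 0, so this case is separate: the
        equation reads \<open>d * t = 0\<close>, and \<open>t > 0\<close> forces
        \<open>d = 0\<close>.\<close>
      case 0
      then show ?thesis using d(2) I(3) that by auto
    next
      case (Suc n)
      have "d * t ^ N + real N * t ^ (N - 1) * g t = t ^ n * (d * t + real N * g t)"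
        using Suc by (simp add: algebra_simps)
      then show ?thesis using d(2) by simp
    qed
    ultimately show ?thesis by simp
  qed
  have "continuous_on I (\<lambda>t. g t * t ^ N)"
    using D by (meson DERIV_isCont continuous_at_imp_continuous_on)
  with D I obtain K where K: "\<And>t. t \<in> I \<Longrightarrow> g t * t ^ N = K"
    using DERIV_zero_connected_constant[of I "{}" "\<lambda>t. g t * t ^ N"] by auto
  have "g t = K * inverse t ^ N" if "t \<in> I" for t
    using K[OF that] I(3) that by (auto simp: field_simps)
  then show thesis using that by blast
qed

lemma inverse_power_has_derivative:
  assumes "t \<noteq> 0"
  shows "((\<lambda>t. b * inverse t ^ N) has_real_derivative (- real N * (b * inverse t ^ N) / t)) (at (t::real))"
  using DERIV_cmult[OF DERIV_power[OF DERIV_inverse[OF assms]], of b N]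
  by (rule DERIV_cong) (cases N; simp add: divide_inverse algebra_simps)

section \<open>Invariance of a multiple of the contact volume as a differential equation for the
  density\<close>

context
  fixes C R :: "'n::finite phase set" and m :: nat and k :: real
    and h :: "'n phase \<Rightarrow> real" and X :: "'n phase \<Rightarrow> 'n phase"
  assumes C: "contact_manifold m C canonical_contact_form" and h: "smooth_on C h"
    and X: "contact_hamiltonian_vector_field C canonical_contact_form h X"
    and k: "\<And>c. c \<in> C \<Longrightarrow> d_dz h c = k"
    and R: "open R" "R \<subseteq> C"
begin

lemma contact_volume_nonzero:
  assumes "c \<in> R"
  obtains v where "contact_volume m canonical_contact_form c v \<noteq> 0"
  using C R(2) assms unfolding contact_manifold_def nonvanishing_on_def by blast

lemma lie_deriv_scale_contact_volume:
  assumes "c \<in> R" "f differentiable at c"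
  shows "lie_deriv (1 + 2 * m) X (scale_form f (contact_volume m canonical_contact_form)) c v =
    (frechet_derivative f (at c) (X c) + real (m + 1) * k * f c) * contact_volume m canonical_contact_form c v"
proof -
  have "lie_deriv (1 + 2 * m) X (contact_volume m canonical_contact_form) c v =
      real (m + 1) * k * contact_volume m canonical_contact_form c v"
    using lie_deriv_contact_volume[OF _ h X k, of c m v] C assms(1) R(2)
    by (auto simp: contact_manifold_def)
  then show ?thesis
    using lie_deriv_scale[where k = "1 + 2 * m" and X = X, OF assms(2)
        differential_form_differentiable[OF differential_form_contact_volume[OF R(1)] assms(1)]]
    by (simp add: algebra_simps)
qed

lemma dim_phase: "DIM('n phase) = 1 + 2 * m"
  using C unfolding contact_manifold_def by simp

lemma invariant_measure_scale_contact_volumeI: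
  assumes "smooth_on R f" "\<And>c. c \<in> R \<Longrightarrow> f c \<noteq> 0"
    and "\<And>c. c \<in> R \<Longrightarrow> frechet_derivative f (at c) (X c) = - (real (m + 1) * k) * f c"
  shows "invariant_measure R X (\<lambda>t. scale_form f (contact_volume m canonical_contact_form))"
  unfolding invariant_measure_def dim_phase
proof (intro conjI allI ballI)
  show "differential_form (1 + 2 * m) R (scale_form f (contact_volume m canonical_contact_form))"
    by (rule differential_form_scale[OF R(1) assms(1) differential_form_contact_volume[OF R(1)]])
  show "nonvanishing_on R (scale_form f (contact_volume m canonical_contact_form))"
    using contact_volume_nonzero assms(2) unfolding nonvanishing_on_def scale_form_def
    by (metis mult_eq_0_iff)
  show "lie_deriv (1 + 2 * m) X (scale_form f (contact_volume m canonical_contact_form)) c v = 0"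
    if "c \<in> R" for c v
    using lie_deriv_scale_contact_volume[OF that smooth_onD[OF assms(1) that]] assms(3)[OF that] by simp
qed simp

text \<open>Smoothness is known for the product form, not for \<open>f\<close>. Choosing vectors on
  which the volume is nonzero at \<open>c\<close>, hence near \<open>c\<close>, writes
  \<open>f\<close> locally as a quotient of differentiable functions.\<close>

lemma invariant_measure_scale_contact_volumeD:
  assumes inv: "invariant_measure R X (\<lambda>t. scale_form f (contact_volume m canonical_contact_form))"
    and c: "c \<in> R"
  shows "f c \<noteq> 0" "f differentiable at c"
    "frechet_derivative f (at c) (X c) = - (real (m + 1) * k) * f c"
proof -
  let ?V = "contact_volume m canonical_contact_form :: 'n phase form"
  note form = differential_form_contact_volume[OF R(1), of m]
  have fV: "differential_form (1 + 2 * m) R (scale_form f ?V)" "nonvanishing_on R (scale_form f ?V)"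
    and zero: "lie_deriv (1 + 2 * m) X (scale_form f ?V) c v = 0" for v
    using inv c unfolding invariant_measure_def dim_phase by auto
  obtain v where v: "?V c v \<noteq> 0" by (rule contact_volume_nonzero[OF c])
  have "continuous_on R (\<lambda>y. ?V y v)"
    using form smooth_on_continuous_on unfolding differential_form_def by blast
  then have "open ((\<lambda>y. ?V y v) -` (- {0}) \<inter> R)"
    using continuous_on_open_vimage[OF R(1)] by blast
  moreover have "(\<lambda>y. (f y * ?V y v) / ?V y v) differentiable at c"
    using differential_form_differentiable[OF fV(1) c, of v]
      differential_form_differentiable[OF form c, of v] v
    by (intro differentiable_divide) (auto simp: scale_form_def)
  ultimately show fdiff: "f differentiable at c"
    using c v by (elim differentiable_transform_open[rotated]) auto
  show "f c \<noteq> 0"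
    using fV(2) c by (auto simp: nonvanishing_on_def scale_form_def)
  show "frechet_derivative f (at c) (X c) = - (real (m + 1) * k) * f c"
    using zero[of v] v lie_deriv_scale_contact_volume[OF c fdiff, of v] by simp
qed

end

theorem theorem5p2:
  fixes C :: "'n::finite phase set"
    and \<phi> :: "real ^ 'n \<Rightarrow> real"
    and F :: "'n \<Rightarrow> real ^ 'n \<Rightarrow> real"
    and x0 \<gamma> :: real
    and h :: "'n phase \<Rightarrow> real"
    and X :: "'n phase \<Rightarrow> 'n phase"
    and R :: "'n phase set"
    and Vol :: "'n phase form"
    and f_inv :: "real \<Rightarrow> 'n phase \<Rightarrow> real"
  defines "h \<equiv> model_hamiltonian \<phi> F x0 \<gamma>"
    and "R \<equiv> {c \<in> C. h c > 0}"
    and "Vol \<equiv> contact_volume (CARD('n) + 1) canonical_contact_form"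
    and "f_inv \<equiv> (\<lambda>Z c. 1 / Z * h c powi (- (int CARD('n) + 2)))"
  assumes contact: "contact_manifold (CARD('n) + 1) C canonical_contact_form"
    and phi_smooth: "smooth_on (p_coord ` C) \<phi>"
    and F_smooth: "\<And>a. smooth_on (p_coord ` C) (F a)"
    and F_nonzero: "\<And>a. \<exists>p\<in>p_coord ` C. F a p \<noteq> 0"
    and x0: "x0 \<noteq> 0"
    and gamma: "\<gamma> \<noteq> 0"
    and X: "contact_hamiltonian_vector_field C canonical_contact_form h X"
  shows "(\<forall>Z. Z \<noteq> 0 \<longrightarrow>
            depends_only_through R h (f_inv Z) \<and>
            invariant_measure R X (\<lambda>t. scale_form (f_inv Z) Vol)) \<and>
         (connected C \<longrightarrow>
            (\<forall>f. depends_only_through R h f \<and> invariant_measure R X (\<lambda>t. scale_form f Vol) \<longrightarrow>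
              (\<exists>Z. Z \<noteq> 0 \<and> (\<forall>c\<in>R. f c = f_inv Z c))))"
proof -
  \<comment> \<open>The general lemmas are used with \<open>m = CARD('n) + 1\<close>, so their
    factor \<open>m + 1\<close> is \<open>?N\<close>.\<close>
  let ?N = "CARD('n) + 2"
  have C: "open C" using contact by (simp add: contact_manifold_def)
  have h: "smooth_on C h"
    unfolding h_def by (rule smooth_on_model_hamiltonian[OF C phi_smooth F_smooth])
  have shift: "h (c + s *\<^sub>R (0, 0, 0, 0, 1)) = h c - \<gamma> * s" for c s
    unfolding h_def by (rule model_hamiltonian_z_shift)
  have dz: "d_dz h c = - \<gamma>" if "c \<in> C" for c
    unfolding d_dz_def
    by (rule affine_on_line_frechet_derivative[OF smooth_onD[OF h that]]) (unfold shift, simp)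
  have "R = h -` {0<..} \<inter> C" by (auto simp: R_def)
  then have R: "open R" "R \<subseteq> C"
    using continuous_on_open_vimage[OF C] smooth_on_continuous_on[OF h] by (metis open_greaterThan, simp)
  have hdiff: "h differentiable at c" and hX: "frechet_derivative h (at c) (X c) = - \<gamma> * h c"
    if "c \<in> R" for c
  proof -
    have c: "c \<in> C" using that R(2) by blast
    show "h differentiable at c" by (rule smooth_onD[OF h c])
    show "frechet_derivative h (at c) (X c) = - \<gamma> * h c"
      using hamiltonian_along_field[OF C h X c] dz[OF c] by simp
  qed
  \<comment> \<open>The negative integer power becomes a natural power of the inverse, to which the
    smoothness rules apply.\<close>
  have f_inv: "f_inv Z = (\<lambda>c. 1 / Z * inverse (h c) ^ ?N)" for Z
    unfolding f_inv_def
    by (metis (no_types, opaque_lifting) of_nat_add of_nat_numeral power_int_inverse power_int_minus power_int_of_nat)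
  note invariantI = invariant_measure_scale_contact_volumeI[OF contact h X dz R, folded Vol_def]
  note invariantD = invariant_measure_scale_contact_volumeD[OF contact h X dz R, folded Vol_def]
  have "depends_only_through R h (f_inv Z)" for Z
    by (auto simp: depends_only_through_def f_inv_def)
  moreover have "invariant_measure R X (\<lambda>t. scale_form (f_inv Z) Vol)" if Z: "Z \<noteq> 0" for Z
  proof (rule invariantI)
    show "smooth_on R (f_inv Z)"
      unfolding f_inv using smooth_on_subset[OF h R(2)]
      by (intro smooth_on_mult smooth_on_const smooth_on_power smooth_on_inverse R(1)) (auto simp: R_def)
    show "f_inv Z c \<noteq> 0" if "c \<in> R" for c
      using that Z by (auto simp: f_inv R_def)
    show "frechet_derivative (f_inv Z) (at c) (X c) = - (real (CARD('n) + 1 + 1) * - \<gamma>) * f_inv Z c"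
      if c: "c \<in> R" for c
    proof -
      have "h c \<noteq> 0" using c by (simp add: R_def)
      \<comment> \<open>The power contributes the factor \<open>- ?N / h c\<close>; multiplied by
        the rate \<open>- \<gamma> * h c\<close> of \<open>h\<close> it leaves
        \<open>?N * \<gamma>\<close>, which balances the rate of the volume.\<close>
      from has_derivative_real_compose[OF hdiff[OF c] inverse_power_has_derivative[OF this]]
      have "(f_inv Z has_derivative
          (\<lambda>u. - real ?N * f_inv Z c / h c * frechet_derivative h (at c) u)) (at c)"
        unfolding f_inv .
      from frechet_derivative_at[OF this]
      have "frechet_derivative (f_inv Z) (at c) (X c) = - real ?N * f_inv Z c / h c * (- \<gamma> * h c)"
        using hX[OF c] by metis
      then show ?thesis using \<open>h c \<noteq> 0\<close> by (simp, simp add: algebra_simps)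
    qed
  qed
  moreover have "\<exists>Z. Z \<noteq> 0 \<and> (\<forall>c\<in>R. f c = f_inv Z c)"
    if "connected C" and dep: "depends_only_through R h f"
      and inv: "invariant_measure R X (\<lambda>t. scale_form f Vol)"
    for f
  proof (cases "R = {}")
    case True
    \<comment> \<open>On an empty region any nonzero constant serves.\<close>
    then show ?thesis by (intro exI[of _ 1]) simp
  next
    case False
    then obtain c0 where c0: "c0 \<in> R" by blast
    obtain g where g: "\<And>c. c \<in> R \<Longrightarrow> f c = g (h c)"
      using dep unfolding depends_only_through_def by blast
    define I where "I = h ` R"
    have I_eq: "I = h ` C \<inter> {0<..}" by (auto simp: I_def R_def)
    have "is_interval (h ` C)"
      using connected_continuous_image[OF smooth_on_continuous_on[OF h] \<open>connected C\<close>]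
      by (simp add: is_interval_connected_1)
    then have "connected I"
      unfolding I_eq using is_interval_Int[OF _ is_interval_oi[of 0]] by (simp add: is_interval_connected_1)
    moreover have "open I"
      unfolding open_contains_ball
    proof (safe, unfold I_def, safe)
      fix c assume "c \<in> R"
      \<comment> \<open>Moving along z inside the open set \<open>R\<close> realises every value
        close to \<open>h c\<close>, so the value set of \<open>h\<close> is open.\<close>
      let ?l = "\<lambda>t. c + ((h c - t) / \<gamma>) *\<^sub>R (0, 0, 0, 0, 1)"
      have l: "h (?l t) = t" for t using gamma by (simp only: shift) simp
      have "continuous_on UNIV ?l" by (intro continuous_intros) (use gamma in auto)
      then have "open (?l -` R)" using R(1) open_vimage by blast
      moreover have "h c \<in> ?l -` R" using \<open>c \<in> R\<close> by (simp flip: zero_prod_def)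
      ultimately obtain e where "e > 0" "ball (h c) e \<subseteq> ?l -` R" using open_contains_ball by blast
      moreover have "t \<in> h ` R" if "?l t \<in> R" for t using l[of t] that by (metis image_eqI)
      ultimately show "\<exists>e>0. ball (h c) e \<subseteq> h ` R" by blast
    qed
    moreover have "\<exists>d. (g has_real_derivative d) (at t) \<and> d * t = - real ?N * g t" if "t \<in> I" for t
    proof -
      obtain c where c: "c \<in> R" "t = h c" using \<open>t \<in> I\<close> by (auto simp: I_def)
      have "f differentiable at c" "frechet_derivative f (at c) (X c) = real ?N * \<gamma> * f c"
        using invariantD[OF _ inv c(1)] by auto
      from euler_equation_of_density[OF R(1) c(1) gamma hdiff[OF c(1)] shift this(1) g hX[OF c(1)] this(2)]
      show ?thesis using c(2) by blast
    qed
    moreover have "I \<subseteq> {0<..}" by (simp add: I_eq)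
    ultimately obtain K where K: "\<And>t. t \<in> I \<Longrightarrow> g t = K * inverse t ^ ?N"
      using euler_equation_homogeneous[of I g ?N] by blast
    have fK: "f c = K * inverse (h c) ^ ?N" if "c \<in> R" for c
      using g K that by (simp add: I_def)
    \<comment> \<open>A single point of \<open>R\<close> suffices: there the invariant measure is
      nonzero, so \<open>K\<close> cannot vanish and \<open>Z = 1 / K\<close> is a legitimate
      constant.\<close>
    have "K \<noteq> 0" using fK[OF c0] invariantD[OF _ inv c0] by auto
    then show ?thesis by (intro exI[of _ "1 / K"]) (auto simp: f_inv fK)
  qed
  ultimately show ?thesis by blast
qed

end
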